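(* Let $A\in\mathcal A_{\$}(\mathbf X)$ be a rich band-dominated operator on $\mathbf X=l^p(\mathbb Z^N,X)$. Then $$\|A+\mathcal K(\mathbf X,\mathcal P)\|=\max_{A_g\in\sigma_{\rm op}(A)}\|A_g\|,$$ where the left-hand side is the quotient norm $\inf\{\|A+K\|:K\in\mathcal K(\mathbf X,\mathcal P)\}$; in particular, the supremum of $\|A_g\|$ over all limit operators $A_g$ of $A$ is attained as a maximum.
   Context: Let $N\in\mathbb N$, $p\in\{0\}\cup[1,\infty]$, and let $X\ne\{0\}$ be a complex Banach space. $\mathbf X=l^p(\mathbb Z^N,X)$ is the space of sequences $x=(x_i)_{i\in\mathbb Z^N}$, $x_i\in X$, with the usual $p$-norm for $1\le p\le\infty$; $l^0(\mathbb Z^N,X)$ denotes the closure in $l^\infty(\mathbb Z^N,X)$ of the finitely supported sequences. $\mathcal L(\mathbf X)$ is the algebra of bounded linear operators. For $M\subset\mathbb Z^N$, $\chi_MI$ is multiplication by the characteristic function of $M$. $P_n:=\chi_{\{-n,\dots,n\}^N}I$, $Q_n:=I-P_n$ ($n\in\mathbb N$), $\mathcal P:=(P_n)$. $\mathcal K(\mathbf X,\mathcal P):=\{K\in\mathcal L(\mathbf X):\|Q_nK\|+\|KQ_n\|\to0\}$ ($\mathcal P$-compact operators); $\mathcal L(\mathbf X,\mathcal P):=\{A\in\mathcal L(\mathbf X): AK,KA\in\mathcal K(\mathbf X,\mathcal P)\ \forall K\in\mathcal K(\mathbf X,\mathcal P)\}$, a closed subalgebra of $\mathcal L(\mathbf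 X)$ containing $\mathcal K(\mathbf X,\mathcal P)$ as a closed two-sided ideal. $(A_n)\subset\mathcal L(\mathbf X)$ converges $\mathcal P$-strongly to $A$ if $\|K(A_n-A)\|+\|(A_n-A)K\|\to0$ for every $K\in\mathcal K(\mathbf X,\mathcal P)$. Shifts: $(V_kx)_i=x_{i-k}$ for $k\in\mathbb Z^N$. For $A\in\mathcal L(\mathbf X,\mathcal P)$ and a sequence $h=(h_n)\subset\mathbb Z^N$ with $|h_n|\to\infty$, the limit operator $A_h$ is the $\mathcal P$-strong limit of $V_{-h_n}AV_{h_n}$, if it exists. $\sigma_{\rm op}(A)$ is the set of all limit operators of $A$. $A$ is rich if every $h\subset\mathbb Z^N$ tending to infinity has a subsequence $g$ such that $A_g$ exists. A band operator is a finite sum $\sum_\alpha a_\alpha V_\alpha$ with $\alpha\in\mathbb Z^N$, $a_\alpha\in l^\infty(\mathbb Z^N,\mathcal L(X))$ acting by $(a_\alpha x)_i=a_\alpha(i)x_i$. $\mathcal A(\mathbf X)$ (band-dominated operators) is the norm closure in $\mathcal L(\mathbf X)$ of the set of band operators; $\mathcal K(\mathbf X,\mathcal P)\subset\mathcal A(\mathbf X)\subset\mathcal L(\mathbf X,\mathcal P)$. $\mathcal A_{\$}(\mathbf X)$ is the set of all rich band-dominated operators. *)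

theory Defs
  imports "HOL-Analysis.Analysis" "HOL-Library.Function_Algebras"
begin

text \<open>Complex Banach spaces: a Banach space whose real structure and norm come from a
  complex scalar multiplication.\<close>

class complex_banach = banach +
  fixes scaleC :: "complex \<Rightarrow> 'a \<Rightarrow> 'a"  (infixr "*\<^sub>C" 75)
  assumes scaleC_add_right: "c *\<^sub>C (x + y) = c *\<^sub>C x + c *\<^sub>C y"
    and scaleC_add_left: "(c + d) *\<^sub>C x = c *\<^sub>C x + d *\<^sub>C x"
    and scaleC_scaleC: "c *\<^sub>C d *\<^sub>C x = (c * d) *\<^sub>C x"
    and scaleR_scaleC: "r *\<^sub>R x = complex_of_real r *\<^sub>C x"
    and norm_scaleC: "norm (c *\<^sub>C x) = cmod c * norm x"

text \<open>The lattice of dimension \<open>N = CARD('n)\<close> is \<open>int ^ 'n\<close>. Sums and differences of sequences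
  and of operators are the pointwise ones of \<open>Function_Algebras\<close>; the product of operators is
  composition.\<close>

type_synonym ('n, 'a) lattice_seq = "(int, 'n) vec \<Rightarrow> 'a"

type_synonym ('n, 'a) seq_op = "('n, 'a) lattice_seq \<Rightarrow> ('n, 'a) lattice_seq"


text \<open>The exponent ranges over \<open>{0} \<union> [1, \<infinity>]\<close>; exponent \<open>0\<close> carries the supremum norm.\<close>

definition lp_norm :: "ereal \<Rightarrow> ('n::finite, 'a::complex_banach) lattice_seq \<Rightarrow> real" where
  "lp_norm p x =
    (if p = 0 \<or> p = \<infinity> then (SUP i. norm (x i))
     else (\<Sum>\<^sub>\<infinity>i. norm (x i) powr real_of_ereal p) powr (1 / real_of_ereal p))"

definition lp_space :: "ereal \<Rightarrow> ('n::finite, 'a::complex_banach) lattice_seq set" where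
  "lp_space p =
    (if p = 0 then
       {x. bounded (range x) \<and>
           (\<forall>\<epsilon>>0. \<exists>y. finite {i. y i \<noteq> 0} \<and> lp_norm \<infinity> (x - y) < \<epsilon>)}
     else if p = \<infinity> then {x. bounded (range x)}
     else {x. (\<lambda>i. norm (x i) powr real_of_ereal p) summable_on UNIV})"

text \<open>An operator on the sequence space is a function on all sequences that vanishes off the
  space, so that two operators are equal as functions iff they agree on the space, and sums,
  differences and composites of operators are again of this form.\<close>

definition on_lp :: "ereal \<Rightarrow> ('n::finite, 'a::complex_banach) seq_op \<Rightarrow> ('n, 'a) seq_op" where
  "on_lp p F = (\<lambda>x. if x \<in> lp_space p then F x else 0)"

definition bounded_ops :: "ereal \<Rightarrow> ('n::finite, 'a::complex_banach) seq_op set" where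
  "bounded_ops p =
    {A. (\<forall>x\<in>lp_space p. A x \<in> lp_space p) \<and>
        (\<forall>x. x \<notin> lp_space p \<longrightarrow> A x = 0) \<and>
        (\<forall>x\<in>lp_space p. \<forall>y\<in>lp_space p. A (x + y) = A x + A y) \<and>
        (\<forall>c. \<forall>x\<in>lp_space p. A (\<lambda>i. c *\<^sub>C x i) = (\<lambda>i. c *\<^sub>C A x i)) \<and>
        (\<exists>C. \<forall>x\<in>lp_space p. lp_norm p (A x) \<le> C * lp_norm p x)}"

definition op_norm :: "ereal \<Rightarrow> ('n::finite, 'a::complex_banach) seq_op \<Rightarrow> real" where
  "op_norm p A = (SUP x\<in>{x \<in> lp_space p. lp_norm p x \<le> 1}. lp_norm p (A x))"

definition P_op :: "ereal \<Rightarrow> nat \<Rightarrow> ('n::finite, 'a::complex_banach) seq_op" where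
  "P_op p n = on_lp p (\<lambda>x i. if \<forall>j. \<bar>i $ j\<bar> \<le> int n then x i else 0)"

definition Q_op :: "ereal \<Rightarrow> nat \<Rightarrow> ('n::finite, 'a::complex_banach) seq_op" where
  "Q_op p n = on_lp p (\<lambda>x. x) - P_op p n"

definition shift_op :: "ereal \<Rightarrow> int ^ 'n \<Rightarrow> ('n::finite, 'a::complex_banach) seq_op" where
  "shift_op p k = on_lp p (\<lambda>x i. x (i - k))"

definition P_compact_ops :: "ereal \<Rightarrow> ('n::finite, 'a::complex_banach) seq_op set" where
  "P_compact_ops p =
    {K \<in> bounded_ops p. (\<lambda>n. op_norm p (Q_op p n \<circ> K) + op_norm p (K \<circ> Q_op p n)) \<longlonglongrightarrow> 0}"

definition P_strongly_tendsto ::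
    "ereal \<Rightarrow> (nat \<Rightarrow> ('n::finite, 'a::complex_banach) seq_op) \<Rightarrow> ('n, 'a) seq_op \<Rightarrow> bool" where
  "P_strongly_tendsto p A B \<longleftrightarrow>
    (\<forall>n. A n \<in> bounded_ops p) \<and> B \<in> bounded_ops p \<and>
    (\<forall>K\<in>P_compact_ops p.
      (\<lambda>n. op_norm p (K \<circ> (A n - B)) + op_norm p ((A n - B) \<circ> K)) \<longlonglongrightarrow> 0)"

definition tends_to_infinity :: "(nat \<Rightarrow> int ^ 'n::finite) \<Rightarrow> bool" where
  "tends_to_infinity h \<longleftrightarrow> filterlim (\<lambda>n. Max (range (\<lambda>j. \<bar>h n $ j\<bar>))) at_top sequentially"

definition is_limit_op ::
    "ereal \<Rightarrow> ('n::finite, 'a::complex_banach) seq_op \<Rightarrow> (nat \<Rightarrow> int ^ 'n) \<Rightarrow> ('n, 'a) seq_op \<Rightarrow> bool"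
  where
  "is_limit_op p A h B \<longleftrightarrow>
    tends_to_infinity h \<and>
    P_strongly_tendsto p (\<lambda>n. shift_op p (- h n) \<circ> A \<circ> shift_op p (h n)) B"

definition op_spectrum ::
    "ereal \<Rightarrow> ('n::finite, 'a::complex_banach) seq_op \<Rightarrow> ('n, 'a) seq_op set" where
  "op_spectrum p A = {B. \<exists>h. is_limit_op p A h B}"

definition rich :: "ereal \<Rightarrow> ('n::finite, 'a::complex_banach) seq_op \<Rightarrow> bool" where
  "rich p A \<longleftrightarrow>
    (\<forall>h. tends_to_infinity h \<longrightarrow> (\<exists>r. strict_mono r \<and> (\<exists>B. is_limit_op p A (h \<circ> r) B)))"

text \<open>The type \<open>'a \<Rightarrow>\<^sub>L 'a\<close> consists of real-linear maps, hence the explicit homogeneity.\<close>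

definition band_coeffs :: "((int, 'n::finite) vec \<Rightarrow> 'a::complex_banach \<Rightarrow>\<^sub>L 'a) set" where
  "band_coeffs =
    {a. bounded (range a) \<and>
        (\<forall>i c x. blinfun_apply (a i) (c *\<^sub>C x) = c *\<^sub>C blinfun_apply (a i) x)}"

definition mult_op ::
    "ereal \<Rightarrow> ((int, 'n::finite) vec \<Rightarrow> 'a::complex_banach \<Rightarrow>\<^sub>L 'a) \<Rightarrow> ('n, 'a) seq_op" where
  "mult_op p a = on_lp p (\<lambda>x i. blinfun_apply (a i) (x i))"

definition band_ops :: "ereal \<Rightarrow> ('n::finite, 'a::complex_banach) seq_op set" where
  "band_ops p =
    {(\<Sum>\<alpha>\<in>F. mult_op p (a \<alpha>) \<circ> shift_op p \<alpha>) | F a. finite F \<and> (\<forall>\<alpha>\<in>F. a \<alpha> \<in> band_coeffs)}"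

definition band_dominated_ops :: "ereal \<Rightarrow> ('n::finite, 'a::complex_banach) seq_op set" where
  "band_dominated_ops p =
    {A \<in> bounded_ops p. \<forall>\<epsilon>>0. \<exists>B\<in>band_ops p. op_norm p (A - B) < \<epsilon>}"

definition rich_band_dominated_ops :: "ereal \<Rightarrow> ('n::finite, 'a::complex_banach) seq_op set" where
  "rich_band_dominated_ops p = {A \<in> band_dominated_ops p. rich p A}"

definition quotient_norm :: "ereal \<Rightarrow> ('n::finite, 'a::complex_banach) seq_op \<Rightarrow> real" where
  "quotient_norm p A = (INF K\<in>P_compact_ops p. op_norm p (A + K))"

end

theory Submission imports Defs begin

text \<open>
  The essential norm of \<open>A\<close> is compared with its limit operators from two sides.

  No limit operator exceeds it (\<open>op_norm_limit_op_le\<close>). Shifting does not change norms, and a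
  \<open>\<P>\<close>-compact \<open>K\<close> is small on the output side far away from the origin. A limit operator \<open>B\<close>,
  seen through a fixed cube, is a norm limit of pieces of \<open>A\<close> seen through cubes that move to
  infinity, and on those cubes \<open>A\<close> and \<open>A + K\<close> are almost the same. Hence
  \<open>\<parallel>B\<parallel> \<le> \<parallel>A + K\<parallel>\<close> for every \<open>K\<close>.

  Conversely, \<open>A P\<^sub>n\<close> is \<open>\<P>\<close>-compact for band-dominated \<open>A\<close>, so the essential norm \<open>c\<close> is at most
  \<open>\<parallel>A Q\<^sub>n\<parallel>\<close> for every \<open>n\<close> (\<open>quotient_norm_le_tail\<close>). The norm of a band-dominated operator
  localizes (\<open>op_norm_localization\<close>): for each \<open>\<delta> > 0\<close> there is one size \<open>D\<close> such that the
  restriction of \<open>A\<close> to sequences supported in any set \<open>F\<close> keeps its norm, up to \<open>\<delta>\<close>, when \<open>F\<close> is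
  replaced by a suitable part of \<open>F\<close> of diameter at most \<open>D\<close>. This is an averaging argument over
  all translates of a cube: enlarging the cube by the band width costs only the ratio of the two
  numbers of lattice points, which tends to \<open>1\<close> as the cube grows.

  To get a maximum and not only a supremum, the localizations with \<open>\<delta> = 2\<^sup>-\<^sup>k\<close> are nested
  (\<open>simultaneous_localization\<close>): starting outside the cube of radius \<open>n\<close>, the support shrinks first to
  diameter \<open>D n\<close>, then to \<open>D (n - 1)\<close>, and so on down to \<open>D 0\<close>. A point \<open>h n\<close> of the last set is then
  a centre at which all scales \<open>k \<le> n\<close> are good simultaneously:
  the restriction of \<open>A\<close> to the cube of radius \<open>D k\<close> about \<open>h n\<close> has norm at least \<open>c - 2 / 2\<^sup>k\<close>.
  These centres tend to infinity, richness gives a limit operator \<open>B\<close> along a subsequence, and in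
  the limit \<open>B\<close> restricted to the cube of radius \<open>D k\<close> about the origin has norm at least
  \<open>c - 2 / 2\<^sup>k\<close>, for every \<open>k\<close>. So \<open>\<parallel>B\<parallel> \<ge> c\<close>.
\<close>

section \<open>The spaces \<open>l\<^sup>p\<close> as solid normed sequence spaces\<close>

text \<open>Convexity of the power function on the closed half line; the boundary point \<open>0\<close> is covered
  by \<open>c\<^sup>q \<le> c\<close> for \<open>0 \<le> c \<le> 1\<close>.\<close>
lemma powr_convex_nonneg:
  fixes q l u v :: real
  assumes "1 \<le> q" "0 \<le> l" "l \<le> 1" "0 \<le> u" "0 \<le> v"
  shows "((1 - l) * u + l * v) powr q \<le> (1 - l) * u powr q + l * v powr q"
proof -
  have shrink: "(c * w) powr q \<le> c * w powr q" if "0 \<le> c" "c \<le> 1" "0 \<le> w" for c w :: real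
  proof -
    have "c powr q \<le> c powr 1"
      using that \<open>1 \<le> q\<close> by (intro powr_mono') auto
    then show ?thesis
      using that by (simp add: powr_mult mult_right_mono)
  qed
  consider "u = 0" | "v = 0" | "0 < u" "0 < v"
    using assms by linarith
  then show ?thesis
  proof cases
    case 3
    then show ?thesis
      using convex_onD[OF powr_convex[OF \<open>1 \<le> q\<close>], of l u v] assms by simp
  qed (use shrink[of l v] shrink[of "1 - l" u] assms in auto)
qed

text \<open>The pointwise form of Minkowski's inequality: write \<open>u + v\<close> as \<open>a + b\<close> times a convex
  combination of \<open>u / a\<close> and \<open>v / b\<close> and apply convexity. If \<open>\<Sum> u\<^sup>q \<le> a\<^sup>q\<close> and \<open>\<Sum> v\<^sup>q \<le> b\<^sup>q\<close>, the
  right-hand sides sum up to at most \<open>(a + b)\<^sup>q\<close>.\<close>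
lemma powr_add_le_weighted:
  fixes q a b u v :: real
  assumes "1 \<le> q" "0 < a" "0 < b" "0 \<le> u" "0 \<le> v"
  shows "(u + v) powr q \<le> (a + b) powr q * (a / (a + b) / a powr q) * u powr q
                         + (a + b) powr q * (b / (a + b) / b powr q) * v powr q"
proof -
  have eq: "1 - b / (a + b) = a / (a + b)"
    using assms by (simp add: field_simps)
  have "u + v = (a + b) * ((1 - b / (a + b)) * (u / a) + b / (a + b) * (v / b))"
  proof -
    have "(a + b) * (a / (a + b) * (u / a)) = u" "(a + b) * (b / (a + b) * (v / b)) = v"
      using assms by auto
    then show ?thesis
      unfolding eq by (simp only: distrib_left)
  qed
  then have "(u + v) powr q
      = (a + b) powr q * ((1 - b / (a + b)) * (u / a) + b / (a + b) * (v / b)) powr q"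
    using assms by (metis powr_mult)
  also have "\<dots> \<le> (a + b) powr q *
      ((1 - b / (a + b)) * (u / a) powr q + b / (a + b) * (v / b) powr q)"
    using assms by (intro mult_left_mono powr_convex_nonneg) auto
  also have "\<dots> = (a + b) powr q * (a / (a + b) / a powr q) * u powr q
                + (a + b) powr q * (b / (a + b) / b powr q) * v powr q"
    unfolding eq using assms by (simp add: powr_divide algebra_simps)
  finally show ?thesis .
qed

lemma exponent_cases [consumes 1, case_names sup fin]:
  fixes p :: ereal
  assumes "p = 0 \<or> 1 \<le> p"
  obtains "p = 0 \<or> p = \<infinity>" | q where "p = ereal q" "1 \<le> q"
  using assms by (cases p) auto

lemma lp_norm_sup: "p = 0 \<or> p = \<infinity> \<Longrightarrow> lp_norm p x = (SUP i. norm (x i))"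
  by (simp add: lp_norm_def)

lemma lp_norm_fin:
  "1 \<le> q \<Longrightarrow> lp_norm (ereal q) x = (\<Sum>\<^sub>\<infinity>i. norm (x i) powr q) powr (1 / q)"
  by (auto simp: lp_norm_def)

lemma lp_space_fin:
  "1 \<le> q \<Longrightarrow> x \<in> lp_space (ereal q) \<longleftrightarrow> (\<lambda>i. norm (x i) powr q) summable_on UNIV"
  by (auto simp: lp_space_def)

lemma lp_space_infty: "x \<in> lp_space \<infinity> \<longleftrightarrow> bounded (range x)"
  by (simp add: lp_space_def)

lemma bdd_above_norm: "bounded (range x) \<Longrightarrow> bdd_above (range (\<lambda>i. norm (x i)))"
  by (auto simp: bounded_iff bdd_above_def)

text \<open>The closure of the finitely supported sequences consists of the sequences vanishing at
  infinity. This form makes solidity and stability under sums and shifts evident.\<close>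
lemma lp_space_zero_iff:
  fixes x :: "('n::finite, 'a::complex_banach) lattice_seq"
  shows "x \<in> lp_space 0 \<longleftrightarrow> (\<forall>\<epsilon>>0. finite {i. \<epsilon> \<le> norm (x i)})"
proof
  assume x: "x \<in> lp_space 0"
  show "\<forall>\<epsilon>>0. finite {i. \<epsilon> \<le> norm (x i)}"
  proof (intro allI impI)
    fix \<epsilon> :: real assume "\<epsilon> > 0"
    then obtain y where y: "finite {i. y i \<noteq> 0}" "lp_norm \<infinity> (x - y) < \<epsilon>"
      using x by (auto simp: lp_space_def)
    have "range y \<subseteq> insert 0 (y ` {i. y i \<noteq> 0})" by auto
    then have "bounded (range y)"
      using y(1) by (meson bounded_subset finite_imageI finite_imp_bounded finite_insert)
    moreover have "bounded (range x)" using x by (simp add: lp_space_def)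
    ultimately have "bounded (range (\<lambda>i. x i - y i))"
      using bounded_minus_comp by blast
    then have "norm (x i - y i) < \<epsilon>" for i
      using y(2) cSUP_upper[OF UNIV_I bdd_above_norm, of "\<lambda>i. x i - y i" i]
      by (simp add: lp_norm_def)
    then have "{i. \<epsilon> \<le> norm (x i)} \<subseteq> {i. y i \<noteq> 0}"
      by (smt (verit) Collect_mono_iff diff_zero)
    then show "finite {i. \<epsilon> \<le> norm (x i)}"
      using y(1) finite_subset by blast
  qed
next
  assume fin: "\<forall>\<epsilon>>0. finite {i. \<epsilon> \<le> norm (x i)}"
  have "range x \<subseteq> x ` {i. 1 \<le> norm (x i)} \<union> ball 0 1"
    by (auto simp: image_iff not_le)
  then have "bounded (range x)"
    using fin by (meson bounded_Un bounded_ball bounded_subset finite_imageI finite_imp_bounded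
        zero_less_one)
  moreover have "\<exists>y. finite {i. y i \<noteq> 0} \<and> lp_norm \<infinity> (x - y) < \<epsilon>" if "\<epsilon> > 0" for \<epsilon>
  proof -
    define y where "y = (\<lambda>i. if \<epsilon> / 2 \<le> norm (x i) then x i else 0)"
    have "finite {i. y i \<noteq> 0}"
      by (rule finite_subset[OF _ fin[rule_format, OF half_gt_zero[OF that]]])
        (auto simp: y_def)
    moreover have "lp_norm \<infinity> (x - y) \<le> \<epsilon> / 2"
      using that by (auto simp: lp_norm_def y_def simp del: le_divide_eq_numeral1 intro!: cSUP_least)
    ultimately show ?thesis
      using that by (intro exI[of _ y]) auto
  qed
  ultimately show "x \<in> lp_space 0"
    by (auto simp: lp_space_def)
qed

lemma bounded_lp_sup:
  fixes x :: "('n::finite, 'a::complex_banach) lattice_seq"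
  assumes "p = 0 \<or> p = \<infinity>" "x \<in> lp_space p"
  shows "bounded (range x)"
  using assms by (auto simp: lp_space_def split: if_splits)

lemma norm_le_lp_norm_sup:
  "p = 0 \<or> p = \<infinity> \<Longrightarrow> x \<in> lp_space p \<Longrightarrow> norm (x i) \<le> lp_norm p x"
  unfolding lp_norm_sup by (intro cSUP_upper bdd_above_norm bounded_lp_sup) auto

lemma lp_norm_sup_le:
  "p = 0 \<or> p = \<infinity> \<Longrightarrow> (\<And>i. norm (x i) \<le> C) \<Longrightarrow> lp_norm p x \<le> C"
  unfolding lp_norm_sup by (intro cSUP_least) auto

text \<open>Comparing \<open>q\<close>-th powers removes the outer root from every later estimate.\<close>
lemma lp_norm_fin_le_iff:
  assumes "1 \<le> q" "0 \<le> C"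
  shows "lp_norm (ereal q) x \<le> C \<longleftrightarrow> (\<Sum>\<^sub>\<infinity>i. norm (x i) powr q) \<le> C powr q"
proof -
  have "0 \<le> (\<Sum>\<^sub>\<infinity>i. norm (x i) powr q)" by (intro infsum_nonneg) simp
  then have "(\<Sum>\<^sub>\<infinity>i. norm (x i) powr q) = lp_norm (ereal q) x powr q"
    using assms by (simp add: lp_norm_fin powr_powr)
  moreover have "0 \<le> lp_norm (ereal q) x"
    using assms by (simp add: lp_norm_fin)
  ultimately show ?thesis
    using assms by (metis linorder_not_le powr_less_mono2 powr_mono2 less_le_trans zero_less_one order.trans zero_le_one)
qed

context
  fixes p :: ereal
  assumes p: "p = 0 \<or> 1 \<le> p"
begin

lemma lp_norm_nonneg [simp]: "x \<in> lp_space p \<Longrightarrow> 0 \<le> lp_norm p x"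
  using p
proof (cases rule: exponent_cases)
  case sup
  then show "x \<in> lp_space p \<Longrightarrow> 0 \<le> lp_norm p x"
    using norm_le_lp_norm_sup[OF sup] norm_ge_zero order.trans by blast
qed (simp add: lp_norm_fin)

text \<open>Restriction to subsets, complex scaling, negation and pointwise application of uniformly
  bounded coefficients are all instances of this domination property.\<close>
lemma lp_solid:
  fixes x y :: "('n::finite, 'a::complex_banach) lattice_seq"
  assumes x: "x \<in> lp_space p" and "0 \<le> C" and le: "\<And>i. norm (y i) \<le> C * norm (x i)"
  shows "y \<in> lp_space p" and "lp_norm p y \<le> C * lp_norm p x"
proof -
  have "y \<in> lp_space p \<and> lp_norm p y \<le> C * lp_norm p x"
    using p
  proof (cases rule: exponent_cases)
    case sup
    have "norm (y i) \<le> C * lp_norm p x" for i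
      using le[of i] norm_le_lp_norm_sup[OF sup x, of i] \<open>0 \<le> C\<close>
      by (meson mult_left_mono order.trans)
    moreover from this have "bounded (range y)"
      by (auto simp: bounded_iff)
    moreover have "finite {i. \<epsilon> \<le> norm (y i)}" if "p = 0" "\<epsilon> > 0" for \<epsilon>
    proof (rule finite_subset)
      show "{i. \<epsilon> \<le> norm (y i)} \<subseteq> {i. \<epsilon> / (C + 1) \<le> norm (x i)}"
      proof safe
        fix i assume "\<epsilon> \<le> norm (y i)"
        also have "\<dots> \<le> C * norm (x i)" by (rule le)
        also have "\<dots> \<le> (C + 1) * norm (x i)" by (simp add: distrib_right)
        finally show "\<epsilon> / (C + 1) \<le> norm (x i)"
          using \<open>0 \<le> C\<close> by (simp add: field_simps)
      qed
      show "finite {i. \<epsilon> / (C + 1) \<le> norm (x i)}"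
        using x that \<open>0 \<le> C\<close> by (simp add: lp_space_zero_iff)
    qed
    ultimately show ?thesis
      using sup by (auto simp: lp_space_zero_iff lp_space_infty intro!: lp_norm_sup_le)
  next
    case (fin q)
    have sx: "(\<lambda>i. norm (x i) powr q) summable_on UNIV"
      using x fin by (simp add: lp_space_fin)
    have le': "norm (y i) powr q \<le> C powr q * norm (x i) powr q" for i
      using powr_mono2[OF _ _ le[of i], of q] fin \<open>0 \<le> C\<close> by (simp add: powr_mult)
    have sy: "(\<lambda>i. norm (y i) powr q) summable_on UNIV"
      by (rule summable_on_comparison_test[OF summable_on_cmult_right[OF sx]]) (use le' in auto)
    have "(\<Sum>\<^sub>\<infinity>i. norm (y i) powr q) \<le> (\<Sum>\<^sub>\<infinity>i. C powr q * norm (x i) powr q)"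
      using le' sy by (intro infsum_mono summable_on_cmult_right sx) auto
    also have "\<dots> = (C * lp_norm p x) powr q"
      using fin \<open>0 \<le> C\<close>
      by (simp add: infsum_cmult_right' lp_norm_fin powr_mult powr_powr infsum_nonneg)
    finally show ?thesis
      using fin sy \<open>0 \<le> C\<close> lp_norm_nonneg[OF x]
      by (simp add: lp_norm_fin_le_iff lp_space_fin)
  qed
  then show "y \<in> lp_space p" "lp_norm p y \<le> C * lp_norm p x" by auto
qed

lemma zero_mem_lp [simp]:
  "(0 :: ('n::finite, 'a::complex_banach) lattice_seq) \<in> lp_space p"
  using p
proof (cases rule: exponent_cases)
  case sup
  then show ?thesis
    by (auto simp: lp_space_zero_iff lp_space_infty)
qed (simp add: lp_space_fin)

lemma lp_norm_zero [simp]: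
  "lp_norm p (0 :: ('n::finite, 'a::complex_banach) lattice_seq) = 0"
proof -
  have "lp_norm p (0 :: ('n, 'a) lattice_seq) \<le> 0 * lp_norm p (0 :: ('n, 'a) lattice_seq)"
    by (rule lp_solid(2)) auto
  moreover have "0 \<le> lp_norm p (0 :: ('n, 'a) lattice_seq)"
    by (rule lp_norm_nonneg) simp
  ultimately show ?thesis by simp
qed

text \<open>For finite exponents, Minkowski's inequality is proved for any strict upper bounds \<open>a\<close>, \<open>b\<close> of
  the two norms, so that vanishing norms need no separate treatment.\<close>
lemma lp_add:
  fixes x y :: "('n::finite, 'a::complex_banach) lattice_seq"
  assumes x: "x \<in> lp_space p" and y: "y \<in> lp_space p"
  shows "x + y \<in> lp_space p" and "lp_norm p (x + y) \<le> lp_norm p x + lp_norm p y"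
proof -
  have "x + y \<in> lp_space p \<and> lp_norm p (x + y) \<le> lp_norm p x + lp_norm p y"
    using p
  proof (cases rule: exponent_cases)
    case sup
    have "norm (x i + y i) \<le> lp_norm p x + lp_norm p y" for i
      using norm_le_lp_norm_sup[OF sup x, of i] norm_le_lp_norm_sup[OF sup y, of i]
      by (meson add_mono norm_triangle_le)
    moreover from this have "bounded (range (x + y))"
      by (auto simp: bounded_iff)
    moreover have "finite {i. \<epsilon> \<le> norm (x i + y i)}" if "p = 0" "\<epsilon> > 0" for \<epsilon>
    proof (rule finite_subset)
      show "{i. \<epsilon> \<le> norm (x i + y i)} \<subseteq> {i. \<epsilon> / 2 \<le> norm (x i)} \<union> {i. \<epsilon> / 2 \<le> norm (y i)}"
        by (auto, smt (verit) field_sum_of_halves norm_triangle_ineq)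
      show "finite ({i. \<epsilon> / 2 \<le> norm (x i)} \<union> {i. \<epsilon> / 2 \<le> norm (y i)})"
        using x y half_gt_zero[OF \<open>0 < \<epsilon>\<close>]
        unfolding \<open>p = 0\<close> lp_space_zero_iff finite_Un by blast
    qed
    ultimately show ?thesis
      using sup by (auto simp: lp_space_zero_iff lp_space_infty intro!: lp_norm_sup_le)
  next
    case (fin q)
    have sx: "(\<lambda>i. norm (x i) powr q) summable_on UNIV"
      and sy: "(\<lambda>i. norm (y i) powr q) summable_on UNIV"
      using x y fin by (simp_all add: lp_space_fin)
    define \<alpha> where "\<alpha> = (\<lambda>a b :: real. (a + b) powr q * (a / (a + b) / a powr q))"
    have pw: "norm (x i + y i) powr q \<le> \<alpha> a b * norm (x i) powr q + \<alpha> b a * norm (y i) powr q"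
      if "0 < a" "0 < b" for a b i
    proof -
      have "norm (x i + y i) powr q \<le> (norm (x i) + norm (y i)) powr q"
        using fin by (intro powr_mono2 norm_triangle_ineq) auto
      also have "\<dots> \<le> \<alpha> a b * norm (x i) powr q + \<alpha> b a * norm (y i) powr q"
        using powr_add_le_weighted[OF fin(2) that, of "norm (x i)" "norm (y i)"]
        by (simp add: \<alpha>_def add.commute)
      finally show ?thesis .
    qed
    have sr: "(\<lambda>i. \<alpha> a b * norm (x i) powr q + \<alpha> b a * norm (y i) powr q) summable_on UNIV" for a b
      by (intro summable_on_add summable_on_cmult_right sx sy)
    have s: "(\<lambda>i. norm (x i + y i) powr q) summable_on UNIV"
      by (rule summable_on_comparison_test[OF sr[of 1 1]]) (use pw[of 1 1] in auto)
    have "lp_norm p (x + y) \<le> a + b" if "lp_norm p x < a" "lp_norm p y < b" for a b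
    proof -
      have ab: "0 < a" "0 < b"
        using that lp_norm_nonneg[OF x] lp_norm_nonneg[OF y] by auto
      have le: "(\<Sum>\<^sub>\<infinity>i. norm (x i) powr q) \<le> a powr q" "(\<Sum>\<^sub>\<infinity>i. norm (y i) powr q) \<le> b powr q"
        using that ab fin lp_norm_fin_le_iff[of q] by (metis less_imp_le)+
      have "(\<Sum>\<^sub>\<infinity>i. norm (x i + y i) powr q)
          \<le> (\<Sum>\<^sub>\<infinity>i. \<alpha> a b * norm (x i) powr q + \<alpha> b a * norm (y i) powr q)"
        using pw[OF ab] by (intro infsum_mono s sr) auto
      also have "\<dots> = \<alpha> a b * (\<Sum>\<^sub>\<infinity>i. norm (x i) powr q) + \<alpha> b a * (\<Sum>\<^sub>\<infinity>i. norm (y i) powr q)"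
        by (simp add: infsum_add summable_on_cmult_right sx sy infsum_cmult_right')
      also have "\<dots> \<le> \<alpha> a b * a powr q + \<alpha> b a * b powr q"
        using ab by (intro add_mono mult_left_mono le) (auto simp: \<alpha>_def)
      also have "\<dots> = (a + b) powr q"
        using ab by (simp add: \<alpha>_def add.commute[of b a] flip: distrib_left add_divide_distrib)
      finally show ?thesis
        using fin ab by (simp add: lp_norm_fin_le_iff)
    qed
    from this[of "lp_norm p x + e / 2" "lp_norm p y + e / 2" for e]
    have "lp_norm p (x + y) \<le> lp_norm p x + lp_norm p y + e" if "0 < e" for e
      using that by (smt (verit) field_sum_of_halves)
    then show ?thesis
      using s fin by (auto simp: lp_space_fin intro: field_le_epsilon)
  qed
  then show "x + y \<in> lp_space p" "lp_norm p (x + y) \<le> lp_norm p x + lp_norm p y" by auto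
qed

end

section \<open>Covering the lattice by cubes\<close>

definition restr :: "'i set \<Rightarrow> ('i \<Rightarrow> 'a::zero) \<Rightarrow> 'i \<Rightarrow> 'a"
  where "restr S x = (\<lambda>i. if i \<in> S then x i else 0)"

text \<open>Balls of the maximum metric on the lattice.\<close>
definition cube :: "int ^ 'n \<Rightarrow> nat \<Rightarrow> (int ^ 'n) set"
  where "cube z n = {i. \<forall>j. \<bar>i $ j - z $ j\<bar> \<le> int n}"

lemma cube_subset:
  assumes "i \<in> cube z m"
  shows "cube i n \<subseteq> cube z (m + n)"
proof
  fix k assume k: "k \<in> cube i n"
  have "\<bar>k $ j - z $ j\<bar> \<le> int (m + n)" for j
  proof -
    have "\<bar>k $ j - i $ j\<bar> \<le> int n" "\<bar>i $ j - z $ j\<bar> \<le> int m"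
      using assms k by (simp_all add: cube_def)
    then show ?thesis by linarith
  qed
  then show "k \<in> cube z (m + n)" by (simp add: cube_def)
qed

lemma cube_sym: "i \<in> cube z n \<longleftrightarrow> z \<in> cube i n"
  by (simp add: cube_def abs_minus_commute)

lemma cube_translate: "i \<in> cube z n \<longleftrightarrow> i - z \<in> cube 0 n"
  by (simp add: cube_def)

lemma center_mem_cube [simp]: "z \<in> cube z n"
  by (simp add: cube_def)

lemma cube_mono: "m \<le> n \<Longrightarrow> cube z m \<subseteq> cube z n"
proof
  fix i assume "m \<le> n" "i \<in> cube z m"
  then have "\<bar>i $ j - z $ j\<bar> \<le> int m" "int m \<le> int n" for j
    by (simp_all add: cube_def)
  then show "i \<in> cube z n"
    unfolding cube_def mem_Collect_eq by (meson order.trans)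
qed

lemma
  fixes n :: nat
  shows finite_cube_0: "finite (cube 0 n :: (int ^ 'n::finite) set)"
    and card_cube_0: "card (cube 0 n :: (int ^ 'n::finite) set) = (2 * n + 1) ^ CARD('n)"
proof -
  let ?F = "Pi\<^sub>E (UNIV :: 'n set) (\<lambda>_. {- int n..int n})"
  have img: "(cube 0 n :: (int ^ 'n) set) = vec_lambda ` ?F"
  proof (rule set_eqI)
    fix i :: "int ^ 'n"
    have "i \<in> cube 0 n \<longleftrightarrow> vec_nth i \<in> ?F"
      by (auto simp: cube_def PiE_def Pi_def abs_le_iff minus_le_iff)
    also have "\<dots> \<longleftrightarrow> i \<in> vec_lambda ` ?F"
      by (metis (no_types, lifting) UNIV_I image_iff vec_lambda_inverse vec_nth_inverse)
    finally show "i \<in> cube 0 n \<longleftrightarrow> i \<in> vec_lambda ` ?F" .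
  qed
  show "finite (cube 0 n :: (int ^ 'n) set)"
    unfolding img by (intro finite_imageI finite_PiE) auto
  have "inj_on (vec_lambda :: _ \<Rightarrow> int ^ 'n) ?F"
    by (metis inj_onI vec_lambda_inject UNIV_I)
  moreover have "nat (int n + 1 + int n) = 2 * n + 1" by simp
  ultimately show "card (cube 0 n :: (int ^ 'n) set) = (2 * n + 1) ^ CARD('n)"
    unfolding img by (simp add: card_image card_PiE nat_add_distrib)
qed

lemma finite_subset_cube:
  assumes "finite (S :: (int ^ 'n::finite) set)"
  shows "\<exists>n. S \<subseteq> cube 0 n"
proof -
  let ?M = "\<lambda>i :: int ^ 'n. Max (range (\<lambda>j. nat \<bar>i $ j\<bar>))"
  have "i \<in> cube 0 (Max (insert 0 (?M ` S)))" if "i \<in> S" for i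
  proof -
    have "nat \<bar>i $ j\<bar> \<le> Max (insert 0 (?M ` S))" for j
    proof -
      have "nat \<bar>i $ j\<bar> \<le> ?M i" by (intro Max_ge) auto
      also have "\<dots> \<le> Max (insert 0 (?M ` S))"
        using assms that by (intro Max_ge) auto
      finally show ?thesis .
    qed
    then show ?thesis
      by (auto simp: cube_def nat_le_iff simp del: Max_insert)
  qed
  then show ?thesis by blast
qed

text \<open>The lattice has polynomial growth, so a fixed collar of width \<open>w\<close> becomes negligible around
  large cubes.\<close>
lemma cube_card_ratio:
  assumes "(\<epsilon> :: real) > 0"
  shows "\<exists>D. real (card (cube 0 (D + w) :: (int ^ 'n::finite) set))
             \<le> (1 + \<epsilon>) * real (card (cube 0 D :: (int ^ 'n) set))"
proof -
  have "(\<lambda>D. ((2 * real (D + w) + 1) / (2 * real D + 1)) ^ CARD('n)) \<longlonglongrightarrow> 1 ^ CARD('n)"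
  proof (rule tendsto_power)
    have "(\<lambda>D. 1 + 2 * real w * inverse (2 * real D + 1)) \<longlonglongrightarrow> 1 + 2 * real w * 0"
      by (intro tendsto_add tendsto_mult tendsto_const tendsto_inverse_0_at_top
          filterlim_at_top_mono[OF filterlim_real_sequentially] always_eventually) simp
    moreover have "1 + 2 * real w * inverse (2 * real D + 1)
        = (2 * real (D + w) + 1) / (2 * real D + 1)" for D
      by (simp add: field_simps)
    ultimately show "(\<lambda>D. (2 * real (D + w) + 1) / (2 * real D + 1)) \<longlonglongrightarrow> 1" by simp
  qed
  then have "\<forall>\<^sub>F D in sequentially. ((2 * real (D + w) + 1) / (2 * real D + 1)) ^ CARD('n) < 1 + \<epsilon>"
    using assms by (intro order_tendstoD(2)[where y = 1]) auto
  then obtain D where "((2 * real (D + w) + 1) / (2 * real D + 1)) ^ CARD('n) < 1 + \<epsilon>"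
    by (auto simp: eventually_sequentially)
  then have "(2 * real (D + w) + 1) ^ CARD('n) \<le> (1 + \<epsilon>) * (2 * real D + 1) ^ CARD('n)"
    unfolding power_divide by (subst (asm) pos_divide_less_eq) auto
  then show ?thesis
    by (intro exI[of _ D]) (simp add: card_cube_0 add.commute)
qed

lemma infsum_finite_sum:
  fixes f :: "'k \<Rightarrow> 'i \<Rightarrow> real"
  assumes "finite K" "\<And>k. k \<in> K \<Longrightarrow> f k summable_on A"
  shows "(\<lambda>z. \<Sum>k\<in>K. f k z) summable_on A \<and> (\<Sum>\<^sub>\<infinity>z\<in>A. \<Sum>k\<in>K. f k z) = (\<Sum>k\<in>K. infsum (f k) A)"
  using assms by (induction K) (simp_all add: summable_on_add infsum_add)

text \<open>Each lattice point lies in exactly as many translates of a cube as the cube has points; the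
  inner sums are rewritten as finite sums over the cube at the origin and interchanged with
  the outer one.\<close>
lemma sum_over_cubes:
  fixes f :: "int ^ 'n::finite \<Rightarrow> real"
  assumes "f summable_on UNIV"
  shows "(\<lambda>z. \<Sum>\<^sub>\<infinity>i. if i \<in> cube z n then f i else 0) summable_on UNIV"
    and "(\<Sum>\<^sub>\<infinity>z. \<Sum>\<^sub>\<infinity>i. if i \<in> cube z n then f i else 0)
          = real (card (cube 0 n :: (int ^ 'n) set)) * (\<Sum>\<^sub>\<infinity>i. f i)"
proof -
  have bij: "bij_betw (\<lambda>z. z + k) UNIV UNIV" for k :: "int ^ 'n"
    by (rule bij_betw_byWitness[of _ "\<lambda>i. i - k"]) auto
  have inner: "(\<Sum>\<^sub>\<infinity>i. if i \<in> cube z n then f i else 0) = (\<Sum>k\<in>cube 0 n. f (z + k))" for z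
  proof -
    have "(\<Sum>\<^sub>\<infinity>i. if i \<in> cube z n then f i else 0)
        = (\<Sum>\<^sub>\<infinity>k. if k + z \<in> cube z n then f (k + z) else 0)"
      using infsum_reindex_bij_betw[OF bij, of "\<lambda>i. if i \<in> cube z n then f i else 0" z] by simp
    also have "\<dots> = (\<Sum>\<^sub>\<infinity>k\<in>cube 0 n. f (z + k))"
      by (rule infsum_cong_neutral)
        (auto simp: cube_translate[of "_ + z"] add.commute)
    also have "\<dots> = (\<Sum>k\<in>cube 0 n. f (z + k))"
      by (simp add: finite_cube_0)
    finally show ?thesis .
  qed
  have s: "(\<lambda>z. f (z + k)) summable_on UNIV" for k
    using assms summable_on_reindex_bij_betw[OF bij, of f k] by simp
  show "(\<lambda>z. \<Sum>\<^sub>\<infinity>i. if i \<in> cube z n then f i else 0) summable_on UNIV"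
    unfolding inner by (rule infsum_finite_sum[THEN conjunct1]) (use s finite_cube_0 in auto)
  have "(\<Sum>\<^sub>\<infinity>z. \<Sum>k\<in>cube 0 n. f (z + k)) = (\<Sum>k\<in>cube 0 n. \<Sum>\<^sub>\<infinity>z. f (z + k))"
    by (rule infsum_finite_sum[THEN conjunct2]) (use s finite_cube_0 in auto)
  also have "\<dots> = (\<Sum>k\<in>(cube 0 n :: (int ^ 'n) set). \<Sum>\<^sub>\<infinity>i. f i)"
    by (intro sum.cong refl infsum_reindex_bij_betw[OF bij])
  finally show "(\<Sum>\<^sub>\<infinity>z. \<Sum>\<^sub>\<infinity>i. if i \<in> cube z n then f i else 0)
          = real (card (cube 0 n :: (int ^ 'n) set)) * (\<Sum>\<^sub>\<infinity>i. f i)"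
    unfolding inner by simp
qed

lemma tends_to_infinity_iff:
  fixes h :: "nat \<Rightarrow> int ^ 'n::finite"
  shows "tends_to_infinity h \<longleftrightarrow> (\<forall>k. \<forall>\<^sub>F n in sequentially. h n \<notin> cube 0 k)"
proof -
  have cube: "h n \<in> cube 0 k \<longleftrightarrow> Max (range (\<lambda>j. \<bar>h n $ j\<bar>)) \<le> int k" for n k
    by (subst Max_le_iff) (auto simp: cube_def)
  show ?thesis
    unfolding tends_to_infinity_def filterlim_at_top
  proof safe
    fix k assume *: "\<forall>Z. \<forall>\<^sub>F n in sequentially. Z \<le> Max (range (\<lambda>j. \<bar>h n $ j\<bar>))"
    show "\<forall>\<^sub>F n in sequentially. h n \<notin> cube 0 k"
      unfolding cube using *[rule_format, of "int k + 1"] by eventually_elim linarith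
  next
    fix Z :: int assume *: "\<forall>k. \<forall>\<^sub>F n in sequentially. h n \<notin> cube 0 k"
    show "\<forall>\<^sub>F n in sequentially. Z \<le> Max (range (\<lambda>j. \<bar>h n $ j\<bar>))"
      using *[rule_format, of "nat Z"] unfolding cube by eventually_elim linarith
  qed
qed

context
  fixes p :: ereal
  assumes p: "p = 0 \<or> 1 \<le> p"
begin

lemma lp_restr:
  fixes x :: "('n::finite, 'a::complex_banach) lattice_seq"
  assumes "x \<in> lp_space p"
  shows "restr S x \<in> lp_space p" "lp_norm p (restr S x) \<le> lp_norm p x"
  using lp_solid[OF p assms, of 1 "restr S x"] by (simp_all add: restr_def)

lemma lp_scaleC:
  fixes x :: "('n::finite, 'a::complex_banach) lattice_seq"
  assumes "x \<in> lp_space p"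
  shows "(\<lambda>i. c *\<^sub>C x i) \<in> lp_space p" "lp_norm p (\<lambda>i. c *\<^sub>C x i) \<le> cmod c * lp_norm p x"
  using lp_solid[OF p assms, of "cmod c" "\<lambda>i. c *\<^sub>C x i"] by (simp_all add: norm_scaleC)

lemma lp_diff:
  fixes x y :: "('n::finite, 'a::complex_banach) lattice_seq"
  assumes "x \<in> lp_space p" "y \<in> lp_space p"
  shows "x - y \<in> lp_space p" "lp_norm p (x - y) \<le> lp_norm p x + lp_norm p y"
proof -
  have m: "- y \<in> lp_space p" "lp_norm p (- y) \<le> lp_norm p y"
    using lp_solid[OF p assms(2), of 1 "- y"] by simp_all
  show "x - y \<in> lp_space p" "lp_norm p (x - y) \<le> lp_norm p x + lp_norm p y"
    using lp_add[OF p assms(1) m(1)] m(2) by simp_all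
qed

lemma lp_shift:
  fixes x :: "('n::finite, 'a::complex_banach) lattice_seq"
  assumes x: "x \<in> lp_space p"
  shows "(\<lambda>i. x (i - k)) \<in> lp_space p" "lp_norm p (\<lambda>i. x (i - k)) = lp_norm p x"
proof -
  have bij: "bij_betw (\<lambda>i. i - k) UNIV UNIV"
    by (rule bij_betw_byWitness[of _ "\<lambda>i. i + k"]) auto
  then have rng: "range (\<lambda>i. f (i - k)) = range f" for f :: "int ^ 'n \<Rightarrow> 'b"
    by (metis (no_types) bij_betw_imp_surj_on image_image)
  have "(\<lambda>i. x (i - k)) \<in> lp_space p \<and> lp_norm p (\<lambda>i. x (i - k)) = lp_norm p x"
    using p
  proof (cases rule: exponent_cases)
    case sup
    have "finite {i. \<epsilon> \<le> norm (x (i - k))}" if "p = 0" "\<epsilon> > 0" for \<epsilon>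
    proof -
      have "{i. \<epsilon> \<le> norm (x (i - k))} = (\<lambda>i. i + k) ` {i. \<epsilon> \<le> norm (x i)}"
        by (auto simp: image_iff) (metis diff_add_cancel)
      then show ?thesis using x that by (simp add: lp_space_zero_iff)
    qed
    moreover have "range (\<lambda>i. x (i - k)) = range x" by (rule rng)
    moreover have "lp_norm p (\<lambda>i. x (i - k)) = lp_norm p x"
      using rng[of "\<lambda>i. norm (x i)"] by (simp add: lp_norm_sup[OF sup])
    ultimately show ?thesis
      using sup x by (auto simp: lp_space_zero_iff lp_space_infty)
  next
    case (fin q)
    then show ?thesis
      using x infsum_reindex_bij_betw[OF bij, of "\<lambda>i. norm (x i) powr q"]
        summable_on_reindex_bij_betw[OF bij, of "\<lambda>i. norm (x i) powr q"]
      by (simp add: lp_space_fin lp_norm_fin)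
  qed
  then show "(\<lambda>i. x (i - k)) \<in> lp_space p" "lp_norm p (\<lambda>i. x (i - k)) = lp_norm p x" by auto
qed

text \<open>A Fatou property: norms in \<open>l\<^sup>p\<close> are determined by finite sections, also for exponents where
  the finitely supported sequences are not dense.\<close>
lemma lp_norm_le_if_cubes:
  fixes x :: "('n::finite, 'a::complex_banach) lattice_seq"
  assumes x: "x \<in> lp_space p" and le: "\<And>n. lp_norm p (restr (cube 0 n) x) \<le> C"
  shows "lp_norm p x \<le> C"
  using p
proof (cases rule: exponent_cases)
  case sup
  show ?thesis
  proof (rule lp_norm_sup_le[OF sup])
    fix i :: "int ^ 'n"
    obtain n where "i \<in> cube 0 n" using finite_subset_cube[of "{i}"] by auto
    then show "norm (x i) \<le> C"
      using norm_le_lp_norm_sup[OF sup lp_restr(1)[OF x], of "cube 0 n" i] le[of n]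
      by (simp add: restr_def)
  qed
next
  case (fin q)
  have C: "0 \<le> C" using lp_norm_nonneg[OF p lp_restr(1)[OF x]] le order.trans by blast
  have "(\<Sum>\<^sub>\<infinity>i. norm (x i) powr q) \<le> C powr q"
  proof (rule infsum_le_finite_sums)
    show "(\<lambda>i. norm (x i) powr q) summable_on UNIV" using x fin by (simp add: lp_space_fin)
    fix F :: "(int ^ 'n) set" assume "finite F"
    then obtain n where n: "F \<subseteq> cube 0 n" using finite_subset_cube by blast
    have "(\<Sum>i\<in>F. norm (x i) powr q) = (\<Sum>i\<in>F. norm (restr (cube 0 n) x i) powr q)"
      using n by (intro sum.cong) (auto simp: restr_def)
    also have "\<dots> \<le> (\<Sum>\<^sub>\<infinity>i. norm (restr (cube 0 n) x i) powr q)"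
      using lp_restr(1)[OF x] fin \<open>finite F\<close>
      by (intro finite_sum_le_infsum) (auto simp: lp_space_fin)
    also have "\<dots> \<le> C powr q"
      using le[of n] fin C by (simp add: lp_norm_fin_le_iff)
    finally show "(\<Sum>i\<in>F. norm (x i) powr q) \<le> C powr q" .
  qed
  then show ?thesis using fin C by (simp add: lp_norm_fin_le_iff)
qed

text \<open>If \<open>u\<close> is controlled by \<open>v\<close> on each cube and a larger concentric cube, summing the \<open>q\<close>-th powers
  over all centres controls \<open>u\<close> globally; the loss is the ratio of the two cardinalities, to the
  power \<open>1 / q\<close>, hence at most \<open>1 + \<epsilon>\<close>. For the supremum norm a single centre suffices and there is
  no loss.\<close>
lemma lp_norm_le_of_local_bounds:
  fixes u v :: "('n::finite, 'a::complex_banach) lattice_seq"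
  assumes u: "u \<in> lp_space p" and v: "v \<in> lp_space p" and "0 \<le> M" and "0 \<le> \<epsilon>"
    and local: "\<And>z. lp_norm p (restr (cube z D) u) \<le> M * lp_norm p (restr (cube z E) v)"
    and ratio: "real (card (cube 0 E :: (int ^ 'n) set))
                  \<le> (1 + \<epsilon>) * real (card (cube 0 D :: (int ^ 'n) set))"
  shows "lp_norm p u \<le> (1 + \<epsilon>) * M * lp_norm p v"
  using p
proof (cases rule: exponent_cases)
  case sup
  show ?thesis
  proof (rule lp_norm_sup_le[OF sup])
    fix i
    have "norm (u i) \<le> lp_norm p (restr (cube i D) u)"
      using norm_le_lp_norm_sup[OF sup lp_restr(1)[OF u], of "cube i D" i] by (simp add: restr_def)
    also have "\<dots> \<le> M * lp_norm p (restr (cube i E) v)" by (rule local)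
    also have "\<dots> \<le> M * lp_norm p v"
      by (intro mult_left_mono lp_restr v \<open>0 \<le> M\<close>)
    also have "\<dots> \<le> (1 + \<epsilon>) * M * lp_norm p v"
      using \<open>0 \<le> M\<close> \<open>0 \<le> \<epsilon>\<close> lp_norm_nonneg[OF p v] by (simp add: distrib_right)
    finally show "norm (u i) \<le> (1 + \<epsilon>) * M * lp_norm p v" .
  qed
next
  case (fin q)
  define U V where "U = (\<Sum>\<^sub>\<infinity>i. norm (u i) powr q)" and "V = (\<Sum>\<^sub>\<infinity>i. norm (v i) powr q)"
  let ?cD = "real (card (cube 0 D :: (int ^ 'n) set))"
  let ?cE = "real (card (cube 0 E :: (int ^ 'n) set))"
  have su: "(\<lambda>i. norm (u i) powr q) summable_on UNIV"
    and sv: "(\<lambda>i. norm (v i) powr q) summable_on UNIV"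
    using u v fin by (simp_all add: lp_space_fin)
  have restr_powr: "norm (restr S w i) powr q = (if i \<in> S then norm (w i) powr q else 0)"
    for S i and w :: "('n, 'a) lattice_seq"
    by (simp add: restr_def)
  have V0: "0 \<le> V" unfolding V_def by (intro infsum_nonneg) simp
  have "?cD * U = (\<Sum>\<^sub>\<infinity>z. \<Sum>\<^sub>\<infinity>i. if i \<in> cube z D then norm (u i) powr q else 0)"
    unfolding U_def by (rule sum_over_cubes(2)[OF su, symmetric])
  also have "\<dots> \<le> (\<Sum>\<^sub>\<infinity>z. M powr q * (\<Sum>\<^sub>\<infinity>i. if i \<in> cube z E then norm (v i) powr q else 0))"
  proof (rule infsum_mono)
    fix z
    have "(\<Sum>\<^sub>\<infinity>i. norm (restr (cube z D) u i) powr q)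
        \<le> (M * lp_norm p (restr (cube z E) v)) powr q"
      using local[of z] fin \<open>0 \<le> M\<close> lp_norm_nonneg[OF p lp_restr(1)[OF v]]
      by (subst lp_norm_fin_le_iff[symmetric]) auto
    also have "\<dots> = M powr q * (\<Sum>\<^sub>\<infinity>i. norm (restr (cube z E) v i) powr q)"
      using fin \<open>0 \<le> M\<close> by (simp add: lp_norm_fin powr_mult powr_powr infsum_nonneg)
    finally show "(\<Sum>\<^sub>\<infinity>i. if i \<in> cube z D then norm (u i) powr q else 0)
        \<le> M powr q * (\<Sum>\<^sub>\<infinity>i. if i \<in> cube z E then norm (v i) powr q else 0)"
      unfolding restr_powr .
  qed (intro summable_on_cmult_right sum_over_cubes su sv)+
  also have "\<dots> = M powr q * (?cE * V)"
    unfolding V_def by (simp add: infsum_cmult_right' sum_over_cubes(2)[OF sv])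
  also have "\<dots> \<le> M powr q * ((1 + \<epsilon>) * ?cD * V)"
    using ratio V0 by (intro mult_left_mono mult_right_mono) auto
  finally have "?cD * U \<le> ?cD * ((1 + \<epsilon>) * M powr q * V)"
    by (simp add: algebra_simps)
  moreover have "0 < ?cD" by (simp add: card_cube_0)
  ultimately have "U \<le> (1 + \<epsilon>) * M powr q * V"
    by (simp only: mult_le_cancel_left_pos)
  also have "\<dots> \<le> (1 + \<epsilon>) powr q * M powr q * V"
  proof (intro mult_right_mono V0)
    have "(1 + \<epsilon>) powr 1 \<le> (1 + \<epsilon>) powr q"
      using fin \<open>0 \<le> \<epsilon>\<close> by (intro powr_mono) auto
    then show "1 + \<epsilon> \<le> (1 + \<epsilon>) powr q" using \<open>0 \<le> \<epsilon>\<close> by simp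
  qed simp
  also have "\<dots> = ((1 + \<epsilon>) * M * lp_norm p v) powr q"
    using fin \<open>0 \<le> M\<close> \<open>0 \<le> \<epsilon>\<close> V0
    by (simp add: lp_norm_fin powr_mult powr_powr V_def[symmetric])
  finally show ?thesis
    using fin \<open>0 \<le> M\<close> \<open>0 \<le> \<epsilon>\<close> lp_norm_nonneg[OF p v]
    by (simp add: lp_norm_fin_le_iff U_def)
qed

end

section \<open>Bounded operators and their norm\<close>

definition chi_op :: "ereal \<Rightarrow> (int ^ 'n) set \<Rightarrow> ('n::finite, 'a::complex_banach) seq_op"
  where "chi_op p S = on_lp p (restr S)"

lemma P_op_eq_chi: "P_op p n = chi_op p (cube 0 n)"
  by (auto simp: P_op_def chi_op_def restr_def cube_def on_lp_def)

lemma Q_op_eq_chi: "Q_op p n = chi_op p (- cube 0 n)"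
  by (auto simp: Q_op_def P_op_eq_chi chi_op_def restr_def on_lp_def fun_eq_iff)

lemma bounded_ops_mem: "A \<in> bounded_ops p \<Longrightarrow> x \<in> lp_space p \<Longrightarrow> A x \<in> lp_space p"
  by (simp add: bounded_ops_def)

lemma bounded_ops_off: "A \<in> bounded_ops p \<Longrightarrow> x \<notin> lp_space p \<Longrightarrow> A x = 0"
  by (simp add: bounded_ops_def)

lemma bounded_ops_add:
  "A \<in> bounded_ops p \<Longrightarrow> x \<in> lp_space p \<Longrightarrow> y \<in> lp_space p \<Longrightarrow> A (x + y) = A x + A y"
  by (simp add: bounded_ops_def)

lemma bounded_ops_scaleC:
  "A \<in> bounded_ops p \<Longrightarrow> x \<in> lp_space p \<Longrightarrow> A (\<lambda>i. c *\<^sub>C x i) = (\<lambda>i. c *\<^sub>C A x i)"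
  by (simp add: bounded_ops_def)

context
  fixes p :: ereal
  assumes p: "p = 0 \<or> 1 \<le> p"
begin

lemma bounded_opsI:
  fixes A :: "('n::finite, 'a::complex_banach) seq_op"
  assumes "\<And>x. x \<in> lp_space p \<Longrightarrow> A x \<in> lp_space p \<and> lp_norm p (A x) \<le> C * lp_norm p x"
    and "\<And>x. x \<notin> lp_space p \<Longrightarrow> A x = 0"
    and "\<And>x y. x \<in> lp_space p \<Longrightarrow> y \<in> lp_space p \<Longrightarrow> A (x + y) = A x + A y"
    and "\<And>c x. x \<in> lp_space p \<Longrightarrow> A (\<lambda>i. c *\<^sub>C x i) = (\<lambda>i. c *\<^sub>C A x i)"
  shows "A \<in> bounded_ops p"
  unfolding bounded_ops_def using assms by blast

lemma bounded_ops_zero: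
  fixes A :: "('n::finite, 'a::complex_banach) seq_op"
  assumes "A \<in> bounded_ops p"
  shows "A 0 = 0"
  using bounded_ops_add[OF assms zero_mem_lp[OF p] zero_mem_lp[OF p]] by simp

lemma bounded_ops_diff:
  fixes A :: "('n::finite, 'a::complex_banach) seq_op"
  assumes "A \<in> bounded_ops p" "x \<in> lp_space p" "y \<in> lp_space p"
  shows "A (x - y) = A x - A y"
  using bounded_ops_add[OF assms(1) lp_diff(1)[OF p assms(2,3)] assms(3)] by simp

lemma op_norm_le:
  fixes A :: "('n::finite, 'a::complex_banach) seq_op"
  assumes "0 \<le> C" "\<And>x. x \<in> lp_space p \<Longrightarrow> lp_norm p (A x) \<le> C * lp_norm p x"
  shows "op_norm p A \<le> C"
  unfolding op_norm_def
proof (rule cSUP_least)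
  show "{x :: ('n, 'a) lattice_seq. x \<in> lp_space p \<and> lp_norm p x \<le> 1} \<noteq> {}"
    using zero_mem_lp[OF p] lp_norm_zero[OF p] zero_le_one by (metis (mono_tags, lifting) empty_iff mem_Collect_eq)
  fix x :: "('n, 'a) lattice_seq"
  assume "x \<in> {x. x \<in> lp_space p \<and> lp_norm p x \<le> 1}"
  then show "lp_norm p (A x) \<le> C"
    using assms(2)[of x] mult_left_mono[of "lp_norm p x" 1 C] \<open>0 \<le> C\<close> by auto
qed

lemma op_norm_apply_unit:
  fixes A :: "('n::finite, 'a::complex_banach) seq_op"
  assumes A: "A \<in> bounded_ops p" and "x \<in> lp_space p" "lp_norm p x \<le> 1"
  shows "lp_norm p (A x) \<le> op_norm p A"
proof -
  obtain C where C: "\<And>x. x \<in> lp_space p \<Longrightarrow> lp_norm p (A x) \<le> C * lp_norm p x"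
    using A unfolding bounded_ops_def by blast
  have "lp_norm p (A y) \<le> \<bar>C\<bar>" if "y \<in> lp_space p" "lp_norm p y \<le> 1" for y
  proof -
    have "lp_norm p (A y) \<le> \<bar>C\<bar> * lp_norm p y"
      using C[OF that(1)] mult_right_mono[OF abs_ge_self lp_norm_nonneg[OF p that(1)]]
      by (rule order.trans)
    also have "\<dots> \<le> \<bar>C\<bar> * 1" using that by (intro mult_left_mono) auto
    finally show ?thesis by simp
  qed
  then have "bdd_above ((\<lambda>x. lp_norm p (A x)) ` {x \<in> lp_space p. lp_norm p x \<le> 1})"
    by (auto intro!: bdd_aboveI[where M = "\<bar>C\<bar>"])
  then show ?thesis
    unfolding op_norm_def using assms by (intro cSUP_upper) auto
qed

lemma op_norm_nonneg:
  fixes A :: "('n::finite, 'a::complex_banach) seq_op"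
  assumes A: "A \<in> bounded_ops p"
  shows "0 \<le> op_norm p A"
  using op_norm_apply_unit[OF A zero_mem_lp[OF p]] lp_norm_zero[OF p, where ?'a = 'a and ?'n = 'n]
  by (simp add: bounded_ops_zero[OF A])

text \<open>Rescaling to the unit ball. When \<open>lp_norm p x = 0\<close> rescaling is impossible, but then any
  constant witnessing boundedness forces the left-hand side to vanish.\<close>
lemma op_norm_apply:
  fixes A :: "('n::finite, 'a::complex_banach) seq_op"
  assumes A: "A \<in> bounded_ops p" and x: "x \<in> lp_space p"
  shows "lp_norm p (A x) \<le> op_norm p A * lp_norm p x"
proof (cases "lp_norm p x = 0")
  case True
  obtain C where "lp_norm p (A x) \<le> C * lp_norm p x"
    using A x by (auto simp: bounded_ops_def)
  then show ?thesis using True by simp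
next
  case False
  define t where "t = lp_norm p x"
  have t: "0 < t" using False lp_norm_nonneg[OF p x] by (simp add: t_def)
  define y where "y = (\<lambda>i. complex_of_real (1 / t) *\<^sub>C x i)"
  have y: "y \<in> lp_space p" unfolding y_def by (rule lp_scaleC[OF p x])
  have "lp_norm p y \<le> cmod (complex_of_real (1 / t)) * lp_norm p x"
    unfolding y_def by (rule lp_scaleC[OF p x])
  also have "\<dots> = 1" using t by (simp add: t_def norm_divide)
  finally have y1: "lp_norm p y \<le> 1" .
  have one: "(1::complex) *\<^sub>C v = v" for v :: 'a
    using scaleR_scaleC[of 1 v] by simp
  have "x = (\<lambda>i. complex_of_real t *\<^sub>C y i)"
    using t by (simp add: y_def scaleC_scaleC one flip: of_real_mult)
  then have "A x = (\<lambda>i. complex_of_real t *\<^sub>C A y i)"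
    using bounded_ops_scaleC[OF A y] by metis
  then have "lp_norm p (A x) \<le> t * lp_norm p (A y)"
    using lp_scaleC(2)[OF p bounded_ops_mem[OF A y], of "complex_of_real t"] t by simp
  also have "\<dots> \<le> t * op_norm p A"
    using op_norm_apply_unit[OF A y y1] t by simp
  finally show ?thesis by (simp add: t_def mult.commute)
qed

lemma bounded_ops_plus:
  fixes A B :: "('n::finite, 'a::complex_banach) seq_op"
  assumes A: "A \<in> bounded_ops p" and B: "B \<in> bounded_ops p"
  shows "A + B \<in> bounded_ops p" "op_norm p (A + B) \<le> op_norm p A + op_norm p B"
proof -
  have le: "lp_norm p (A x + B x) \<le> (op_norm p A + op_norm p B) * lp_norm p x"
    if x: "x \<in> lp_space p" for x
    using lp_add(2)[OF p bounded_ops_mem[OF A x] bounded_ops_mem[OF B x]]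
      op_norm_apply[OF A x] op_norm_apply[OF B x] by (simp add: distrib_right)
  show "A + B \<in> bounded_ops p"
  proof (rule bounded_opsI[where C = "op_norm p A + op_norm p B"])
    fix c and x :: "('n, 'a) lattice_seq" assume x: "x \<in> lp_space p"
    show "(A + B) (\<lambda>i. c *\<^sub>C x i) = (\<lambda>i. c *\<^sub>C (A + B) x i)"
      by (rule ext) (simp add: bounded_ops_scaleC[OF A x] bounded_ops_scaleC[OF B x] scaleC_add_right)
  qed (use le A B in \<open>auto simp: bounded_ops_mem lp_add(1)[OF p] bounded_ops_off bounded_ops_add\<close>)
  show "op_norm p (A + B) \<le> op_norm p A + op_norm p B"
    using le by (intro op_norm_le add_nonneg_nonneg op_norm_nonneg A B) auto
qed

lemma bounded_ops_uminus:
  fixes A :: "('n::finite, 'a::complex_banach) seq_op"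
  assumes A: "A \<in> bounded_ops p"
  shows "- A \<in> bounded_ops p" "op_norm p (- A) = op_norm p A"
proof -
  have eq: "- A = (\<lambda>x i. (- 1) *\<^sub>C A x i)"
    using scaleR_scaleC[of "- 1", where ?'a = 'a] by (auto simp: fun_eq_iff)
  have neg: "- y \<in> lp_space p \<and> lp_norm p (- y) = lp_norm p y" if "y \<in> lp_space p"
    for y :: "('n, 'a) lattice_seq"
    using lp_solid[OF p that, of 1 "- y"] lp_solid(2)[OF p _ zero_le_one, of "- y" y] by auto
  show "- A \<in> bounded_ops p"
  proof (rule bounded_opsI[where C = "op_norm p A"])
    fix c and x :: "('n, 'a) lattice_seq" assume x: "x \<in> lp_space p"
    show "(- A) (\<lambda>i. c *\<^sub>C x i) = (\<lambda>i. c *\<^sub>C (- A) x i)"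
      unfolding eq by (rule ext) (simp add: bounded_ops_scaleC[OF A x] scaleC_scaleC)
  qed (use A in \<open>auto simp: neg bounded_ops_mem op_norm_apply bounded_ops_off bounded_ops_add\<close>)
  show "op_norm p (- A) = op_norm p A"
    unfolding op_norm_def by (intro SUP_cong refl) (simp add: neg bounded_ops_mem[OF A])
qed

lemma bounded_ops_minus:
  fixes A B :: "('n::finite, 'a::complex_banach) seq_op"
  assumes A: "A \<in> bounded_ops p" and B: "B \<in> bounded_ops p"
  shows "A - B \<in> bounded_ops p"
  using bounded_ops_plus(1)[OF A bounded_ops_uminus(1)[OF B]] by simp

lemma bounded_ops_comp:
  fixes A B :: "('n::finite, 'a::complex_banach) seq_op"
  assumes A: "A \<in> bounded_ops p" and B: "B \<in> bounded_ops p"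
  shows "A \<circ> B \<in> bounded_ops p" "op_norm p (A \<circ> B) \<le> op_norm p A * op_norm p B"
proof -
  have le: "lp_norm p (A (B x)) \<le> op_norm p A * op_norm p B * lp_norm p x"
    if x: "x \<in> lp_space p" for x
  proof -
    have "lp_norm p (A (B x)) \<le> op_norm p A * lp_norm p (B x)"
      by (rule op_norm_apply[OF A bounded_ops_mem[OF B x]])
    also have "\<dots> \<le> op_norm p A * (op_norm p B * lp_norm p x)"
      by (intro mult_left_mono op_norm_apply op_norm_nonneg A B x)
    finally show ?thesis by (simp add: mult.assoc)
  qed
  show "A \<circ> B \<in> bounded_ops p"
  proof (rule bounded_opsI[where C = "op_norm p A * op_norm p B"])
    fix x y :: "('n, 'a) lattice_seq" assume x: "x \<in> lp_space p" "y \<in> lp_space p"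
    show "(A \<circ> B) (x + y) = (A \<circ> B) x + (A \<circ> B) y"
      unfolding comp_apply bounded_ops_add[OF B x]
      by (rule bounded_ops_add[OF A bounded_ops_mem[OF B x(1)] bounded_ops_mem[OF B x(2)]])
  next
    fix c and x :: "('n, 'a) lattice_seq" assume x: "x \<in> lp_space p"
    show "(A \<circ> B) (\<lambda>i. c *\<^sub>C x i) = (\<lambda>i. c *\<^sub>C (A \<circ> B) x i)"
      unfolding comp_apply bounded_ops_scaleC[OF B x]
      by (rule bounded_ops_scaleC[OF A bounded_ops_mem[OF B x]])
  next
    fix x :: "('n, 'a) lattice_seq" assume "x \<notin> lp_space p"
    then show "(A \<circ> B) x = 0"
      by (simp add: bounded_ops_off[OF B] bounded_ops_zero[OF A])
  qed (simp add: le bounded_ops_mem[OF A] bounded_ops_mem[OF B])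
  show "op_norm p (A \<circ> B) \<le> op_norm p A * op_norm p B"
    using le by (intro op_norm_le mult_nonneg_nonneg op_norm_nonneg A B) auto
qed

lemma zero_bounded_ops:
  "(0 :: ('n::finite, 'a::complex_banach) seq_op) \<in> bounded_ops p"
  "op_norm p (0 :: ('n::finite, 'a::complex_banach) seq_op) = 0"
proof -
  have c0: "c *\<^sub>C 0 = (0 :: 'a)" for c
    using scaleC_add_right[of c 0 "0 :: 'a"] by simp
  show *: "(0 :: ('n, 'a) seq_op) \<in> bounded_ops p"
    by (rule bounded_opsI[where C = 0])
      (auto simp: p lp_norm_zero[OF p] zero_mem_lp[OF p] c0 simp flip: zero_fun_def)
  have "op_norm p (0 :: ('n, 'a) seq_op) \<le> 0"
    by (rule op_norm_le) (auto simp: lp_norm_zero[OF p])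
  then show "op_norm p (0 :: ('n::finite, 'a::complex_banach) seq_op) = 0"
    using op_norm_nonneg[OF *] by simp
qed

lemma bounded_ops_sum:
  fixes f :: "'k \<Rightarrow> ('n::finite, 'a::complex_banach) seq_op"
  assumes "finite F" "\<And>k. k \<in> F \<Longrightarrow> f k \<in> bounded_ops p"
  shows "(\<Sum>k\<in>F. f k) \<in> bounded_ops p"
  using assms by (induction F) (auto simp: zero_bounded_ops bounded_ops_plus)

lemma chi_op_bounded:
  fixes S :: "(int ^ 'n::finite) set"
  shows "(chi_op p S :: ('n, 'a::complex_banach) seq_op) \<in> bounded_ops p"
    and "op_norm p (chi_op p S :: ('n, 'a) seq_op) \<le> 1"
proof -
  have c0: "c *\<^sub>C 0 = (0 :: 'a)" for c
    using scaleC_add_right[of c 0 "0 :: 'a"] by simp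
  show "(chi_op p S :: ('n, 'a) seq_op) \<in> bounded_ops p"
  proof (rule bounded_opsI[where C = 1])
    fix x y :: "('n, 'a) lattice_seq" assume x: "x \<in> lp_space p" "y \<in> lp_space p"
    then show "chi_op p S (x + y) = chi_op p S x + chi_op p S y"
      using lp_add(1)[OF p x] by (auto simp: chi_op_def on_lp_def restr_def)
  next
    fix c and x :: "('n, 'a) lattice_seq" assume x: "x \<in> lp_space p"
    then show "chi_op p S (\<lambda>i. c *\<^sub>C x i) = (\<lambda>i. c *\<^sub>C chi_op p S x i)"
      using lp_scaleC(1)[OF p x, of c] by (auto simp: chi_op_def on_lp_def restr_def c0)
  qed (auto simp: chi_op_def on_lp_def lp_restr[OF p])
  show "op_norm p (chi_op p S :: ('n, 'a) seq_op) \<le> 1"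
    by (rule op_norm_le) (auto simp: chi_op_def on_lp_def lp_restr[OF p])
qed

lemma shift_op_bounded:
  fixes k :: "int ^ 'n::finite"
  shows "(shift_op p k :: ('n, 'a::complex_banach) seq_op) \<in> bounded_ops p"
    and "op_norm p (shift_op p k :: ('n, 'a) seq_op) \<le> 1"
proof -
  show "(shift_op p k :: ('n, 'a) seq_op) \<in> bounded_ops p"
  proof (rule bounded_opsI[where C = 1])
    fix x y :: "('n, 'a) lattice_seq" assume x: "x \<in> lp_space p" "y \<in> lp_space p"
    then show "shift_op p k (x + y) = shift_op p k x + shift_op p k y"
      using lp_add(1)[OF p x] by (auto simp: shift_op_def on_lp_def)
  next
    fix c and x :: "('n, 'a) lattice_seq" assume x: "x \<in> lp_space p"
    then show "shift_op p k (\<lambda>i. c *\<^sub>C x i) = (\<lambda>i. c *\<^sub>C shift_op p k x i)"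
      using lp_scaleC(1)[OF p x, of c] by (auto simp: shift_op_def on_lp_def)
  qed (auto simp: shift_op_def on_lp_def lp_shift[OF p])
  show "op_norm p (shift_op p k :: ('n, 'a) seq_op) \<le> 1"
    by (rule op_norm_le) (auto simp: shift_op_def on_lp_def lp_shift[OF p])
qed

lemma mult_op_bounded:
  fixes a :: "(int, 'n::finite) vec \<Rightarrow> 'a::complex_banach \<Rightarrow>\<^sub>L 'a"
  assumes a: "a \<in> band_coeffs"
  shows "mult_op p a \<in> bounded_ops p"
proof -
  obtain C where C: "\<And>i. norm (a i) \<le> C"
    using a by (auto simp: band_coeffs_def bounded_iff)
  have C0: "0 \<le> C" using C[of 0] norm_ge_zero order.trans by blast
  have le: "norm (blinfun_apply (a i) v) \<le> C * norm v" for i v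
    by (rule order.trans[OF norm_blinfun mult_right_mono[OF C norm_ge_zero]])
  show ?thesis
  proof (rule bounded_opsI[where C = C])
    fix x y :: "('n, 'a) lattice_seq" assume x: "x \<in> lp_space p" "y \<in> lp_space p"
    then show "mult_op p a (x + y) = mult_op p a x + mult_op p a y"
      using lp_add(1)[OF p x] by (auto simp: mult_op_def on_lp_def blinfun.add_right)
  next
    fix c and x :: "('n, 'a) lattice_seq" assume x: "x \<in> lp_space p"
    then show "mult_op p a (\<lambda>i. c *\<^sub>C x i) = (\<lambda>i. c *\<^sub>C mult_op p a x i)"
      using lp_scaleC(1)[OF p x, of c] a by (auto simp: mult_op_def on_lp_def band_coeffs_def)
  next
    fix x :: "('n, 'a) lattice_seq" assume x: "x \<in> lp_space p"
    then show "mult_op p a x \<in> lp_space p \<and> lp_norm p (mult_op p a x) \<le> C * lp_norm p x"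
      using lp_solid[OF p x C0, of "\<lambda>i. blinfun_apply (a i) (x i)"] le
      by (simp add: mult_op_def on_lp_def)
  qed (simp add: mult_op_def on_lp_def)
qed

lemma comp_diff_right:
  fixes A B C :: "('n::finite, 'a::complex_banach) seq_op"
  assumes "A \<in> bounded_ops p" "B \<in> bounded_ops p" "C \<in> bounded_ops p"
  shows "C \<circ> (A - B) = (C \<circ> A) - (C \<circ> B)"
proof (rule ext)
  fix x
  show "(C \<circ> (A - B)) x = ((C \<circ> A) - (C \<circ> B)) x"
  proof (cases "x \<in> lp_space p")
    case True
    then show ?thesis
      using bounded_ops_diff[OF assms(3) bounded_ops_mem[OF assms(1) True]
          bounded_ops_mem[OF assms(2) True]]
      by (simp only: comp_apply minus_apply)
  next
    case False
    then show ?thesis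
      using bounded_ops_off[OF assms(1) False] bounded_ops_off[OF assms(2) False]
        bounded_ops_zero[OF assms(3)] by simp
  qed
qed

lemma chi_op_comp:
  fixes S T :: "(int ^ 'n::finite) set"
  shows "chi_op p S \<circ> chi_op p T = (chi_op p (S \<inter> T) :: ('n, 'a::complex_banach) seq_op)"
proof (rule ext)
  fix x :: "('n, 'a) lattice_seq"
  show "(chi_op p S \<circ> chi_op p T) x = chi_op p (S \<inter> T) x"
    using lp_restr(1)[OF p, of x T] zero_mem_lp[OF p]
    by (auto simp: chi_op_def on_lp_def restr_def)
qed

lemma shift_op_comp:
  fixes h k :: "int ^ 'n::finite"
  shows "shift_op p h \<circ> shift_op p k = (shift_op p (h + k) :: ('n, 'a::complex_banach) seq_op)"
proof (rule ext)
  fix x :: "('n, 'a) lattice_seq"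
  show "(shift_op p h \<circ> shift_op p k) x = shift_op p (h + k) x"
    using lp_shift(1)[OF p, of x k] zero_mem_lp[OF p]
    by (auto simp: shift_op_def on_lp_def diff_diff_eq add.commute)
qed

lemma chi_op_shift:
  fixes h :: "int ^ 'n::finite"
  shows "chi_op p S \<circ> shift_op p h
    = (shift_op p h \<circ> chi_op p {i. i + h \<in> S} :: ('n, 'a::complex_banach) seq_op)"
proof (rule ext)
  fix x :: "('n, 'a) lattice_seq"
  show "(chi_op p S \<circ> shift_op p h) x = (shift_op p h \<circ> chi_op p {i. i + h \<in> S}) x"
    using lp_shift(1)[OF p, of x h] lp_restr(1)[OF p, of x "{i. i + h \<in> S}"] zero_mem_lp[OF p]
    by (auto simp: shift_op_def chi_op_def restr_def on_lp_def)
qed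

lemma comp_shift_0:
  fixes A :: "('n::finite, 'a::complex_banach) seq_op"
  assumes "A \<in> bounded_ops p"
  shows "A \<circ> shift_op p 0 = A"
proof (rule ext)
  fix x show "(A \<circ> shift_op p 0) x = A x"
    using bounded_ops_off[OF assms, of x] bounded_ops_zero[OF assms]
    by (auto simp: shift_op_def on_lp_def)
qed

end

section \<open>Operators of finite propagation\<close>

text \<open>The only property of band operators that matters for localization: the value of \<open>A x\<close> at \<open>i\<close>
  depends on \<open>x\<close> near \<open>i\<close> only. For linear \<open>A\<close> this is equivalent to the vanishing condition below.\<close>
definition propagation_le :: "ereal \<Rightarrow> nat \<Rightarrow> ('n::finite, 'a::complex_banach) seq_op \<Rightarrow> bool"
  where "propagation_le p w A \<longleftrightarrow>
    (\<forall>x\<in>lp_space p. \<forall>i. (\<forall>j\<in>cube i w. x j = 0) \<longrightarrow> A x i = 0)"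

lemma propagation_le_mono: "propagation_le p v A \<Longrightarrow> v \<le> w \<Longrightarrow> propagation_le p w A"
  unfolding propagation_le_def using cube_mono by blast

lemma comp_diff_left: "(A - B) \<circ> C = (A \<circ> C) - (B \<circ> (C :: _ \<Rightarrow> _))"
  by (simp add: fun_eq_iff)

lemma chi_op_empty: "chi_op p {} = (0 :: ('n::finite, 'a::complex_banach) seq_op)"
  by (simp add: chi_op_def restr_def on_lp_def fun_eq_iff)

lemma P_compact_bounded: "K \<in> P_compact_ops p \<Longrightarrow> K \<in> bounded_ops p"
  by (simp add: P_compact_ops_def)

context
  fixes p :: ereal
  assumes p: "p = 0 \<or> 1 \<le> p"
begin

lemma propagation_sum:
  fixes f :: "'k \<Rightarrow> ('n::finite, 'a::complex_banach) seq_op"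
  assumes "finite F" "\<And>k. k \<in> F \<Longrightarrow> \<exists>w. propagation_le p w (f k)"
  shows "\<exists>w. propagation_le p w (\<Sum>k\<in>F. f k)"
  using assms
proof (induction F)
  case empty
  show ?case by (auto simp: propagation_le_def)
next
  case (insert k F)
  then obtain v w where v: "propagation_le p v (f k)" and w: "propagation_le p w (\<Sum>k\<in>F. f k)"
    by (metis insertCI)
  have "propagation_le p (max v w) (f k)" "propagation_le p (max v w) (\<Sum>k\<in>F. f k)"
    using propagation_le_mono[OF v] propagation_le_mono[OF w] by simp_all
  then have "propagation_le p (max v w) (f k + (\<Sum>k\<in>F. f k))"
    by (simp add: propagation_le_def)
  then show ?case unfolding sum.insert[OF insert.hyps] by blast
qed

lemma band_ops_bounded_propagation:
  fixes B :: "('n::finite, 'a::complex_banach) seq_op"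
  assumes "B \<in> band_ops p"
  shows "B \<in> bounded_ops p" "\<exists>w. propagation_le p w B"
proof -
  obtain F and a :: "int ^ 'n \<Rightarrow> int ^ 'n \<Rightarrow> 'a \<Rightarrow>\<^sub>L 'a"
    where B: "B = (\<Sum>\<alpha>\<in>F. mult_op p (a \<alpha>) \<circ> shift_op p \<alpha>)"
      and F: "finite F" and a: "\<And>\<alpha>. \<alpha> \<in> F \<Longrightarrow> a \<alpha> \<in> band_coeffs"
    using assms by (auto simp: band_ops_def)
  show "B \<in> bounded_ops p"
    unfolding B by (intro bounded_ops_sum bounded_ops_comp mult_op_bounded shift_op_bounded p F a)
  show "\<exists>w. propagation_le p w B"
    unfolding B
  proof (rule propagation_sum[OF F])
    fix \<alpha> :: "int ^ 'n"
    obtain w where w: "- \<alpha> \<in> cube 0 w" using finite_subset_cube[of "{- \<alpha>}"] by auto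
    have "i - \<alpha> \<in> cube i w" for i
      using w by (simp add: cube_translate[of "i - \<alpha>"])
    then have "propagation_le p w (mult_op p (a \<alpha>) \<circ> shift_op p \<alpha>)"
      by (auto simp: propagation_le_def mult_op_def shift_op_def on_lp_def)
    then show "\<exists>w. propagation_le p w (mult_op p (a \<alpha>) \<circ> shift_op p \<alpha>)" ..
  qed
qed

lemma propagation_restr:
  fixes B :: "('n::finite, 'a::complex_banach) seq_op"
  assumes B: "B \<in> bounded_ops p" "propagation_le p w B" and x: "x \<in> lp_space p"
    and nbhd: "\<And>i. i \<in> S \<Longrightarrow> cube i w \<subseteq> T"
  shows "restr S (B x) = restr S (B (restr T x))"
proof (rule ext)
  fix i
  show "restr S (B x) i = restr S (B (restr T x)) i"
  proof (cases "i \<in> S")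
    case True
    have "\<forall>j\<in>cube i w. (x - restr T x) j = 0"
      using nbhd[OF True] by (auto simp: restr_def)
    then have "B (x - restr T x) i = 0"
      using B(2) lp_diff(1)[OF p x lp_restr(1)[OF p x]] by (auto simp: propagation_le_def)
    then show ?thesis
      using bounded_ops_diff[OF p B(1) x lp_restr(1)[OF p x], of T] by (simp add: restr_def)
  qed (simp add: restr_def)
qed

lemma op_norm_comp_le_left:
  fixes A B :: "('n::finite, 'a::complex_banach) seq_op"
  assumes A: "A \<in> bounded_ops p" and B: "B \<in> bounded_ops p" "op_norm p B \<le> 1"
  shows "op_norm p (A \<circ> B) \<le> op_norm p A"
  using bounded_ops_comp(2)[OF p A B(1)] mult_left_mono[OF B(2) op_norm_nonneg[OF p A]] by simp

lemma op_norm_comp_le_right: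
  fixes A B :: "('n::finite, 'a::complex_banach) seq_op"
  assumes A: "A \<in> bounded_ops p" and B: "B \<in> bounded_ops p" "op_norm p B \<le> 1"
  shows "op_norm p (B \<circ> A) \<le> op_norm p A"
  using bounded_ops_comp(2)[OF p B(1) A] mult_right_mono[OF B(2) op_norm_nonneg[OF p A]] by simp

lemma op_norm_diff_le:
  fixes A B :: "('n::finite, 'a::complex_banach) seq_op"
  assumes A: "A \<in> bounded_ops p" and B: "B \<in> bounded_ops p"
  shows "op_norm p A \<le> op_norm p B + op_norm p (A - B)"
  using bounded_ops_plus(2)[OF p B bounded_ops_minus[OF p A B]] by simp

lemma op_norm_diff_commute:
  fixes A B :: "('n::finite, 'a::complex_banach) seq_op"
  assumes A: "A \<in> bounded_ops p" and B: "B \<in> bounded_ops p"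
  shows "op_norm p (A - B) = op_norm p (B - A)"
  using bounded_ops_uminus(2)[OF p bounded_ops_minus[OF p A B]] by simp

lemma comp_zero:
  fixes A :: "('n::finite, 'a::complex_banach) seq_op"
  assumes "A \<in> bounded_ops p"
  shows "A \<circ> 0 = 0"
  using bounded_ops_zero[OF p assms] by (simp add: fun_eq_iff)

lemma op_norm_chi_mono:
  fixes A :: "('n::finite, 'a::complex_banach) seq_op"
  assumes A: "A \<in> bounded_ops p" and "S \<subseteq> T"
  shows "op_norm p (A \<circ> chi_op p S) \<le> op_norm p (A \<circ> chi_op p T)"
proof -
  have "A \<circ> chi_op p S = A \<circ> chi_op p T \<circ> chi_op p S"
    using \<open>S \<subseteq> T\<close> by (simp add: comp_assoc chi_op_comp[OF p] Int_absorb1)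
  then show ?thesis
    using op_norm_comp_le_left[OF bounded_ops_comp(1)[OF p A chi_op_bounded(1)[OF p]]
        chi_op_bounded[OF p]] by simp
qed

section \<open>Localization of the operator norm\<close>

text \<open>Finite propagation turns a bound on the pieces of \<open>B\<close> supported in cubes of radius \<open>D + w\<close> into
  local bounds of \<open>B x\<close> on cubes of radius \<open>D\<close>, to which the covering estimate applies.\<close>
lemma op_norm_le_of_local_norms:
  fixes B :: "('n::finite, 'a::complex_banach) seq_op"
  assumes B: "B \<in> bounded_ops p" "propagation_le p w B" and "0 \<le> M" "0 \<le> \<epsilon>"
    and local: "\<And>z. op_norm p (B \<circ> chi_op p (F \<inter> cube z (D + w))) \<le> M"
    and ratio: "real (card (cube 0 (D + w) :: (int ^ 'n) set))
                  \<le> (1 + \<epsilon>) * real (card (cube 0 D :: (int ^ 'n) set))"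
  shows "op_norm p (B \<circ> chi_op p F) \<le> (1 + \<epsilon>) * M"
proof (rule op_norm_le[OF p])
  show "0 \<le> (1 + \<epsilon>) * M" using \<open>0 \<le> M\<close> \<open>0 \<le> \<epsilon>\<close> by simp
  fix x :: "('n, 'a) lattice_seq" assume x: "x \<in> lp_space p"
  have Fx: "restr F x \<in> lp_space p" by (rule lp_restr[OF p x])
  have eq: "(B \<circ> chi_op p F) x = B (restr F x)"
    using x by (simp add: chi_op_def on_lp_def)
  have "lp_norm p (B (restr F x)) \<le> (1 + \<epsilon>) * M * lp_norm p x"
  proof (rule lp_norm_le_of_local_bounds[OF p bounded_ops_mem[OF B(1) Fx] x \<open>0 \<le> M\<close> \<open>0 \<le> \<epsilon>\<close> _ ratio])
    fix z :: "int ^ 'n"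
    let ?T = "cube z (D + w)"
    have Tx: "restr ?T x \<in> lp_space p" by (rule lp_restr[OF p x])
    have BF: "B \<circ> chi_op p (F \<inter> ?T) \<in> bounded_ops p"
      by (intro bounded_ops_comp chi_op_bounded p B)
    have "restr (cube z D) (B (restr F x)) = restr (cube z D) (B (restr ?T (restr F x)))"
      by (rule propagation_restr[OF B Fx]) (rule cube_subset)
    also have "restr ?T (restr F x) = chi_op p (F \<inter> ?T) (restr ?T x)"
      using Tx by (auto simp: restr_def chi_op_def on_lp_def)
    finally have "restr (cube z D) (B (restr F x))
        = restr (cube z D) ((B \<circ> chi_op p (F \<inter> ?T)) (restr ?T x))" by simp
    then have "lp_norm p (restr (cube z D) (B (restr F x)))
        \<le> lp_norm p ((B \<circ> chi_op p (F \<inter> ?T)) (restr ?T x))"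
      using lp_restr(2)[OF p bounded_ops_mem[OF BF Tx]] by simp
    also have "\<dots> \<le> op_norm p (B \<circ> chi_op p (F \<inter> ?T)) * lp_norm p (restr ?T x)"
      by (rule op_norm_apply[OF p BF Tx])
    also have "\<dots> \<le> M * lp_norm p (restr ?T x)"
      by (intro mult_right_mono local lp_norm_nonneg p Tx)
    finally show "lp_norm p (restr (cube z D) (B (restr F x))) \<le> M * lp_norm p (restr ?T x)" .
  qed
  then show "lp_norm p ((B \<circ> chi_op p F) x) \<le> (1 + \<epsilon>) * M * lp_norm p x"
    unfolding eq .
qed

lemma band_dominatedE:
  fixes A :: "('n::finite, 'a::complex_banach) seq_op"
  assumes "A \<in> band_dominated_ops p" "0 < \<epsilon>"
  obtains B w where "B \<in> bounded_ops p" "propagation_le p w B" "op_norm p (A - B) < \<epsilon>"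
  using assms band_ops_bounded_propagation unfolding band_dominated_ops_def by blast

text \<open>The size \<open>D\<close> depends on \<open>A\<close> and \<open>\<delta>\<close> only and not on \<open>F\<close>; this uniformity is what allows
  nesting and escaping to infinity. The piece \<open>H\<close> is required to be nonempty, which excludes the
  degenerate choice when the norm on \<open>F\<close> is at most \<open>\<delta>\<close>; then any point of \<open>F\<close> will do.\<close>
lemma op_norm_localization:
  fixes A :: "('n::finite, 'a::complex_banach) seq_op"
  assumes A: "A \<in> band_dominated_ops p" and "0 < \<delta>"
  shows "\<exists>D. \<forall>F. F \<noteq> {} \<longrightarrow> (\<exists>H\<subseteq>F. H \<noteq> {} \<and> (\<forall>h\<in>H. H \<subseteq> cube h D) \<and>
           op_norm p (A \<circ> chi_op p F) - \<delta> \<le> op_norm p (A \<circ> chi_op p H))"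
proof -
  have Ab: "A \<in> bounded_ops p" using A by (simp add: band_dominated_ops_def)
  obtain B w where B: "B \<in> bounded_ops p" "propagation_le p w B" "op_norm p (A - B) < \<delta> / 3"
    using band_dominatedE[OF A, of "\<delta> / 3"] \<open>0 < \<delta>\<close> by auto
  define N where "N = op_norm p A"
  have N: "0 \<le> N" unfolding N_def by (rule op_norm_nonneg[OF p Ab])
  \<comment> \<open>A third of \<open>\<delta>\<close> is lost on each of the two passages between \<open>A\<close> and \<open>B\<close>; \<open>\<epsilon>\<close> is chosen such that
    the cardinality ratio costs less than the remaining third.\<close>
  define \<epsilon> where "\<epsilon> = \<delta> / (3 * (N + 1))"
  have \<epsilon>: "0 < \<epsilon>" using N \<open>0 < \<delta>\<close> by (simp add: \<epsilon>_def)
  have \<epsilon>N: "\<epsilon> * N < \<delta> / 3" using N \<open>0 < \<delta>\<close> by (simp add: \<epsilon>_def field_simps)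
  obtain D where D: "real (card (cube 0 (D + w) :: (int ^ 'n) set))
      \<le> (1 + \<epsilon>) * real (card (cube 0 D :: (int ^ 'n) set))"
    using cube_card_ratio[OF \<epsilon>] by blast
  let ?E = "D + w"
  have bd: "X \<circ> chi_op p S \<in> bounded_ops p" if "X \<in> bounded_ops p"
    for X :: "('n, 'a) seq_op" and S
    by (intro bounded_ops_comp chi_op_bounded p that)
  have close: "op_norm p ((A \<circ> chi_op p S) - (B \<circ> chi_op p S)) \<le> \<delta> / 3" for S
    using op_norm_comp_le_left[OF bounded_ops_minus[OF p Ab B(1)] chi_op_bounded[OF p], of S] B(3)
    by (simp add: comp_diff_left)
  show ?thesis
  proof (intro exI[of _ "?E + ?E"] allI impI)
    fix F :: "(int ^ 'n) set" assume "F \<noteq> {}"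
    define m where "m = op_norm p (A \<circ> chi_op p F) - \<delta>"
    have "\<exists>H\<subseteq>F. H \<noteq> {} \<and> (\<forall>h\<in>H. H \<subseteq> cube h (?E + ?E)) \<and> m \<le> op_norm p (A \<circ> chi_op p H)"
    proof (rule ccontr)
      assume no: "\<not> ?thesis"
      obtain h where "h \<in> F" using \<open>F \<noteq> {}\<close> by blast
      then have "\<not> m \<le> op_norm p (A \<circ> chi_op p {h})"
        using no by (metis center_mem_cube empty_subsetI insert_not_empty insert_subset singletonD)
      then have m: "0 < m"
        using op_norm_nonneg[OF p bd[OF Ab], of "{h}"] by simp
      \<comment> \<open>Nonempty pieces \<open>F \<inter> cube z ?E\<close> are candidates for \<open>H\<close>, since two of their points are at distance
        at most \<open>?E + ?E\<close>; so all of them violate the claim.\<close>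
      have loc: "op_norm p (A \<circ> chi_op p (F \<inter> cube z ?E)) \<le> m" for z
      proof (cases "F \<inter> cube z ?E = {}")
        case True
        then show ?thesis using m by (simp add: chi_op_empty comp_zero[OF Ab] zero_bounded_ops[OF p])
      next
        case False
        have "F \<inter> cube z ?E \<subseteq> cube h (?E + ?E)" if "h \<in> F \<inter> cube z ?E" for h
          using that cube_subset[of z h ?E ?E] by (auto simp: cube_sym[of h])
        then show ?thesis
          using no False by (meson inf_le1 linear)
      qed
      have "op_norm p (B \<circ> chi_op p (F \<inter> cube z ?E)) \<le> m + \<delta> / 3" for z
        using op_norm_diff_le[OF bd[OF B(1)] bd[OF Ab], of "F \<inter> cube z ?E" "F \<inter> cube z ?E"]
          op_norm_diff_commute[OF bd[OF B(1)] bd[OF Ab], of "F \<inter> cube z ?E" "F \<inter> cube z ?E"]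
          close[of "F \<inter> cube z ?E"] loc[of z] by linarith
      then have "op_norm p (B \<circ> chi_op p F) \<le> (1 + \<epsilon>) * (m + \<delta> / 3)"
        using m \<epsilon> \<open>0 < \<delta>\<close> by (intro op_norm_le_of_local_norms[OF B(1,2) _ _ _ D]) auto
      then have "m + \<delta> \<le> \<delta> / 3 + (1 + \<epsilon>) * (m + \<delta> / 3)"
        using op_norm_diff_le[OF bd[OF Ab] bd[OF B(1)], of F F] close[of F]
        unfolding m_def by linarith
      also have "\<dots> = m + 2 * \<delta> / 3 + \<epsilon> * (m + \<delta> / 3)"
        by (simp add: field_simps)
      also have "\<epsilon> * (m + \<delta> / 3) \<le> \<epsilon> * N"
      proof (intro mult_left_mono)
        have "op_norm p (A \<circ> chi_op p F) \<le> N"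
          unfolding N_def by (intro op_norm_comp_le_left Ab chi_op_bounded p)
        then show "m + \<delta> / 3 \<le> N" using \<open>0 < \<delta>\<close> unfolding m_def by linarith
      qed (use \<epsilon> in simp)
      finally show False using \<epsilon>N by linarith
    qed
    then show "\<exists>H\<subseteq>F. H \<noteq> {} \<and> (\<forall>h\<in>H. H \<subseteq> cube h (?E + ?E)) \<and>
           op_norm p (A \<circ> chi_op p F) - \<delta> \<le> op_norm p (A \<circ> chi_op p H)"
      unfolding m_def .
  qed
qed

text \<open>Localizing successively with tolerances \<open>1 / 2\<^sup>n, \<dots>, 1 / 2, 1\<close>, each time inside the set found
  before, and picking a point of the last set, gives a centre that serves all scales up to \<open>n\<close>. The
  losses down to scale \<open>k\<close> form a geometric sum below \<open>2 / 2\<^sup>k\<close>.\<close>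
lemma simultaneous_localization:
  fixes A :: "('n::finite, 'a::complex_banach) seq_op"
  assumes A: "A \<in> band_dominated_ops p"
  shows "\<exists>D :: nat \<Rightarrow> nat. \<forall>F n. F \<noteq> {} \<longrightarrow> (\<exists>h\<in>F. \<forall>k\<le>n.
           op_norm p (A \<circ> chi_op p F) - 2 / 2 ^ k \<le> op_norm p (A \<circ> chi_op p (cube h (D k))))"
proof -
  have Ab: "A \<in> bounded_ops p" using A by (simp add: band_dominated_ops_def)
  have "\<forall>k. \<exists>D. \<forall>F. F \<noteq> {} \<longrightarrow> (\<exists>H\<subseteq>F. H \<noteq> {} \<and> (\<forall>h\<in>H. H \<subseteq> cube h D) \<and>
           op_norm p (A \<circ> chi_op p F) - 1 / 2 ^ k \<le> op_norm p (A \<circ> chi_op p H))"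
    by (intro allI op_norm_localization A) simp
  then obtain D where D: "\<And>k F. F \<noteq> {} \<Longrightarrow> \<exists>H\<subseteq>F. H \<noteq> {} \<and> (\<forall>h\<in>H. H \<subseteq> cube h (D k)) \<and>
           op_norm p (A \<circ> chi_op p F) - 1 / 2 ^ k \<le> op_norm p (A \<circ> chi_op p H)"
    by metis
  \<comment> \<open>The extra summand \<open>1 / 2 ^ n\<close> is the unused part of the geometric sum; it pays for the localization
    at the next larger scale in the induction step.\<close>
  have nest: "\<exists>h\<in>F. \<forall>k\<le>n. op_norm p (A \<circ> chi_op p F) - 2 / 2 ^ k + 1 / 2 ^ n
         \<le> op_norm p (A \<circ> chi_op p (cube h (D k)))" if "F \<noteq> {}" for F n
    using that
  proof (induction n arbitrary: F)
    case 0
    obtain H where H: "H \<subseteq> F" "H \<noteq> {}" "\<forall>h\<in>H. H \<subseteq> cube h (D 0)"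
        "op_norm p (A \<circ> chi_op p F) - 1 / 2 ^ 0 \<le> op_norm p (A \<circ> chi_op p H)"
      using D[OF 0] by meson
    then obtain h where h: "h \<in> H" "H \<subseteq> cube h (D 0)" by blast
    have "op_norm p (A \<circ> chi_op p F) - 2 / 2 ^ 0 + 1 / 2 ^ 0 \<le> op_norm p (A \<circ> chi_op p (cube h (D 0)))"
      using op_norm_chi_mono[OF Ab h(2)] H(4) by simp
    then show ?case using h(1) H(1) by blast
  next
    case (Suc n)
    obtain H where H: "H \<subseteq> F" "H \<noteq> {}" "\<forall>h\<in>H. H \<subseteq> cube h (D (Suc n))"
        "op_norm p (A \<circ> chi_op p F) - 1 / 2 ^ Suc n \<le> op_norm p (A \<circ> chi_op p H)"
      using D[OF Suc.prems] by meson
    obtain h where h: "h \<in> H" "\<And>k. k \<le> n \<Longrightarrow> op_norm p (A \<circ> chi_op p H) - 2 / 2 ^ k + 1 / 2 ^ n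
         \<le> op_norm p (A \<circ> chi_op p (cube h (D k)))"
      using Suc.IH[OF H(2)] by blast
    have half: "2 / 2 ^ Suc n = 1 / (2 ^ n :: real)" "1 / 2 ^ n = 1 / 2 ^ Suc n + 1 / (2 ^ Suc n :: real)"
      by simp_all
    have "op_norm p (A \<circ> chi_op p F) - 2 / 2 ^ k + 1 / 2 ^ Suc n
         \<le> op_norm p (A \<circ> chi_op p (cube h (D k)))" if "k \<le> Suc n" for k
    proof (cases "k = Suc n")
      case True
      have "H \<subseteq> cube h (D (Suc n))" using H(3) h(1) by blast
      from op_norm_chi_mono[OF Ab this] show ?thesis
        using H(4) half unfolding True by linarith
    next
      case False
      then show ?thesis
        using h(2)[of k] that H(4) half(2) by linarith
    qed
    then show ?case using h(1) H(1) by blast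
  qed
  have "\<exists>h\<in>F. \<forall>k\<le>n. op_norm p (A \<circ> chi_op p F) - 2 / 2 ^ k
      \<le> op_norm p (A \<circ> chi_op p (cube h (D k)))" if "F \<noteq> {}" for F n
  proof -
    obtain h where "h \<in> F" and h: "\<And>k. k \<le> n \<Longrightarrow> op_norm p (A \<circ> chi_op p F) - 2 / 2 ^ k + 1 / 2 ^ n
         \<le> op_norm p (A \<circ> chi_op p (cube h (D k)))"
      using nest[OF \<open>F \<noteq> {}\<close>] by blast
    moreover have "0 < 1 / (2 ^ n :: real)" by simp
    ultimately show ?thesis by (smt (verit))
  qed
  then show ?thesis by blast
qed

section \<open>\<open>\<P>\<close>-compact operators\<close>

lemma P_compactI:
  fixes K :: "('n::finite, 'a::complex_banach) seq_op"
  assumes K: "K \<in> bounded_ops p"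
    and "\<And>\<epsilon>. 0 < \<epsilon> \<Longrightarrow> \<forall>\<^sub>F m in sequentially. op_norm p (chi_op p (- cube 0 m) \<circ> K) < \<epsilon>"
    and "\<And>\<epsilon>. 0 < \<epsilon> \<Longrightarrow> \<forall>\<^sub>F m in sequentially. op_norm p (K \<circ> chi_op p (- cube 0 m)) < \<epsilon>"
  shows "K \<in> P_compact_ops p"
proof -
  have "(\<lambda>m. op_norm p (chi_op p (- cube 0 m) \<circ> K) + op_norm p (K \<circ> chi_op p (- cube 0 m)))
      \<longlonglongrightarrow> 0 + 0"
    by (intro tendsto_add order_tendstoI)
      (use assms in \<open>auto intro!: always_eventually intro: less_le_trans op_norm_nonneg[OF p]
        bounded_ops_comp[OF p] chi_op_bounded[OF p]\<close>)
  then show ?thesis using K by (simp add: P_compact_ops_def Q_op_eq_chi)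
qed

lemma P_compact_tail:
  fixes K :: "('n::finite, 'a::complex_banach) seq_op"
  assumes K: "K \<in> P_compact_ops p" and "0 < \<epsilon>"
  obtains m where "op_norm p (chi_op p (- cube 0 m) \<circ> K) < \<epsilon>"
proof -
  have Kb: "K \<in> bounded_ops p" by (rule P_compact_bounded[OF K])
  have "\<forall>\<^sub>F m in sequentially.
      op_norm p (chi_op p (- cube 0 m) \<circ> K) + op_norm p (K \<circ> chi_op p (- cube 0 m)) < \<epsilon>"
    using K \<open>0 < \<epsilon>\<close> by (auto simp: P_compact_ops_def Q_op_eq_chi intro: order_tendstoD)
  then obtain m where
    "op_norm p (chi_op p (- cube 0 m) \<circ> K) + op_norm p (K \<circ> chi_op p (- cube 0 m)) < \<epsilon>"
    by (auto simp: eventually_sequentially)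
  moreover have "0 \<le> op_norm p (K \<circ> chi_op p (- cube 0 m))"
    by (intro op_norm_nonneg bounded_ops_comp chi_op_bounded p Kb)
  ultimately have "op_norm p (chi_op p (- cube 0 m) \<circ> K) < \<epsilon>" by linarith
  then show thesis by (rule that)
qed

text \<open>For a band operator \<open>B\<close> of width \<open>w\<close> the product \<open>Q\<^sub>m B P\<^sub>n\<close> vanishes as soon as \<open>m \<ge> n + w\<close>;
  approximation in norm transfers this to smallness for \<open>A\<close>.\<close>
lemma P_compact_band_dominated_chi:
  fixes A :: "('n::finite, 'a::complex_banach) seq_op"
  assumes A: "A \<in> band_dominated_ops p"
  shows "A \<circ> chi_op p (cube 0 n) \<in> P_compact_ops p"
proof (rule P_compactI)
  let ?P = "chi_op p (cube 0 n) :: ('n, 'a) seq_op"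
  let ?Q = "\<lambda>m. chi_op p (- cube 0 m) :: ('n, 'a) seq_op"
  have Ab: "A \<in> bounded_ops p" using A by (simp add: band_dominated_ops_def)
  have chi: "chi_op p S \<in> bounded_ops p" for S :: "(int ^ 'n) set" by (rule chi_op_bounded[OF p])
  show "A \<circ> ?P \<in> bounded_ops p" by (intro bounded_ops_comp p Ab chi)
  fix \<epsilon> :: real assume \<epsilon>: "0 < \<epsilon>"
  obtain B w where B: "B \<in> bounded_ops p" "propagation_le p w B" "op_norm p (A - B) < \<epsilon>"
    by (rule band_dominatedE[OF A \<epsilon>])
  have "op_norm p (?Q m \<circ> (A \<circ> ?P)) < \<epsilon>" if "n + w \<le> m" for m
  proof -
    have "?Q m \<circ> (B \<circ> ?P) = 0"
    proof (rule ext)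
      fix x
      show "(?Q m \<circ> (B \<circ> ?P)) x = 0 x"
      proof (cases "x \<in> lp_space p")
        case True
        have Px: "restr (cube 0 n) x \<in> lp_space p" by (rule lp_restr[OF p True])
        have "cube i w \<subseteq> - cube 0 n" if "i \<in> - cube 0 m" for i
        proof safe
          fix j assume "j \<in> cube i w" "j \<in> cube 0 n"
          then have "i \<in> cube j w" "cube j w \<subseteq> cube 0 (n + w)"
            using cube_sym cube_subset by blast+
          then have "i \<in> cube 0 (n + w)" by blast
          then show False
            using that \<open>n + w \<le> m\<close> cube_mono[of "n + w" m 0] by blast
        qed
        then have "restr (- cube 0 m) (B (restr (cube 0 n) x))
            = restr (- cube 0 m) (B (restr (- cube 0 n) (restr (cube 0 n) x)))"
          by (rule propagation_restr[OF B(1,2) Px])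
        also have "restr (- cube 0 n) (restr (cube 0 n) x) = 0"
          by (simp add: restr_def fun_eq_iff)
        finally have "restr (- cube 0 m) (B (restr (cube 0 n) x)) = 0"
          unfolding bounded_ops_zero[OF p B(1)] by (simp add: restr_def fun_eq_iff)
        then show ?thesis
          using True by (simp add: chi_op_def on_lp_def)
      next
        case False
        then show ?thesis
          by (simp add: bounded_ops_off[OF chi False] bounded_ops_zero[OF p B(1)]
              bounded_ops_zero[OF p chi])
      qed
    qed
    then have eq: "?Q m \<circ> (A \<circ> ?P) = ?Q m \<circ> ((A - B) \<circ> ?P)"
      using comp_diff_right[OF p, of "A \<circ> ?P" "B \<circ> ?P" "?Q m"] Ab B(1)
      by (simp add: comp_diff_left bounded_ops_comp[OF p] chi)
    have "op_norm p (?Q m \<circ> (A \<circ> ?P)) \<le> op_norm p ((A - B) \<circ> ?P)"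
      unfolding eq by (intro op_norm_comp_le_right bounded_ops_comp bounded_ops_minus chi_op_bounded p Ab B)
    also have "\<dots> \<le> op_norm p (A - B)"
      by (intro op_norm_comp_le_left bounded_ops_minus chi_op_bounded p Ab B)
    finally show ?thesis using B(3) by simp
  qed
  then show "\<forall>\<^sub>F m in sequentially. op_norm p (?Q m \<circ> (A \<circ> ?P)) < \<epsilon>"
    by (auto simp: eventually_sequentially)
  have "op_norm p (A \<circ> ?P \<circ> ?Q m) < \<epsilon>" if "n \<le> m" for m
  proof -
    have "cube 0 n \<inter> - cube 0 m = ({} :: (int ^ 'n) set)"
      using cube_mono[OF that] by blast
    then show ?thesis
      using \<epsilon> by (simp add: comp_assoc chi_op_comp[OF p] chi_op_empty comp_zero[OF Ab]
          zero_bounded_ops[OF p])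
  qed
  then show "\<forall>\<^sub>F m in sequentially. op_norm p (A \<circ> ?P \<circ> ?Q m) < \<epsilon>"
    by (auto simp: eventually_sequentially)
qed

lemma P_compact_chi:
  "(chi_op p (cube 0 n) :: ('n::finite, 'a::complex_banach) seq_op) \<in> P_compact_ops p"
proof (rule P_compactI)
  fix \<epsilon> :: real assume \<epsilon>: "0 < \<epsilon>"
  have "op_norm p (chi_op p (- cube 0 m) \<circ> chi_op p (cube 0 n) :: ('n, 'a) seq_op) < \<epsilon>"
    "op_norm p (chi_op p (cube 0 n) \<circ> chi_op p (- cube 0 m) :: ('n, 'a) seq_op) < \<epsilon>"
    if "n \<le> m" for m
  proof -
    have "cube 0 n \<inter> - cube 0 m = ({} :: (int ^ 'n) set)"
      using cube_mono[OF that] by blast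
    then show "op_norm p (chi_op p (- cube 0 m) \<circ> chi_op p (cube 0 n) :: ('n, 'a) seq_op) < \<epsilon>"
      "op_norm p (chi_op p (cube 0 n) \<circ> chi_op p (- cube 0 m) :: ('n, 'a) seq_op) < \<epsilon>"
      using \<epsilon> by (simp_all add: chi_op_comp[OF p] Int_commute chi_op_empty zero_bounded_ops[OF p])
  qed
  then show "\<forall>\<^sub>F m in sequentially.
      op_norm p (chi_op p (- cube 0 m) \<circ> chi_op p (cube 0 n) :: ('n, 'a) seq_op) < \<epsilon>"
    "\<forall>\<^sub>F m in sequentially.
      op_norm p (chi_op p (cube 0 n) \<circ> chi_op p (- cube 0 m) :: ('n, 'a) seq_op) < \<epsilon>"
    by (auto simp: eventually_sequentially)
qed (rule chi_op_bounded[OF p])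

lemma P_compact_uminus:
  fixes K :: "('n::finite, 'a::complex_banach) seq_op"
  assumes K: "K \<in> P_compact_ops p"
  shows "- K \<in> P_compact_ops p"
proof -
  have Kb: "K \<in> bounded_ops p" by (rule P_compact_bounded[OF K])
  have "Q_op p n \<circ> (- K) = - (Q_op p n \<circ> K)" for n
    using comp_diff_right[OF p zero_bounded_ops(1)[OF p] Kb chi_op_bounded(1)[OF p], of "- cube 0 n"]
      comp_zero[OF chi_op_bounded(1)[OF p, where ?'a = 'a and ?'n = 'n], of "- cube 0 n"]
    by (simp add: Q_op_eq_chi)
  moreover have "(- K) \<circ> Q_op p n = - (K \<circ> Q_op p n)" for n
    by (simp add: fun_eq_iff)
  moreover have "Q_op p n \<circ> K \<in> bounded_ops p" "K \<circ> Q_op p n \<in> bounded_ops p" for n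
    unfolding Q_op_eq_chi by (intro bounded_ops_comp chi_op_bounded p Kb)+
  ultimately show ?thesis
    using K by (simp add: P_compact_ops_def bounded_ops_uminus[OF p])
qed

section \<open>Limit operators and the essential norm\<close>

text \<open>Testing \<open>\<P>\<close>-strong convergence against the \<open>\<P>\<close>-compact projections onto cubes.\<close>
lemma limit_op_tendsto:
  fixes A B :: "('n::finite, 'a::complex_banach) seq_op"
  assumes "is_limit_op p A h B" and A: "A \<in> bounded_ops p" and "0 < \<epsilon>"
  defines "A' \<equiv> \<lambda>n. shift_op p (- h n) \<circ> A \<circ> shift_op p (h n)"
  shows "\<forall>\<^sub>F n in sequentially. op_norm p (chi_op p (cube 0 m) \<circ> (A' n - B)) < \<epsilon>"
    and "\<forall>\<^sub>F n in sequentially. op_norm p ((A' n - B) \<circ> chi_op p (cube 0 m)) < \<epsilon>"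
proof -
  let ?P = "chi_op p (cube 0 m) :: ('n, 'a) seq_op"
  have lim: "(\<lambda>n. op_norm p (?P \<circ> (A' n - B)) + op_norm p ((A' n - B) \<circ> ?P)) \<longlonglongrightarrow> 0"
    and B: "B \<in> bounded_ops p"
    using assms P_compact_chi by (auto simp: is_limit_op_def P_strongly_tendsto_def)
  have "A' n \<in> bounded_ops p" for n
    unfolding A'_def by (intro bounded_ops_comp shift_op_bounded p A)
  then have nn: "0 \<le> op_norm p (?P \<circ> (A' n - B))" "0 \<le> op_norm p ((A' n - B) \<circ> ?P)" for n
    by (intro op_norm_nonneg bounded_ops_comp bounded_ops_minus chi_op_bounded p B; blast)+
  have ev: "\<forall>\<^sub>F n in sequentially. op_norm p (?P \<circ> (A' n - B)) + op_norm p ((A' n - B) \<circ> ?P) < \<epsilon>"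
    using lim \<open>0 < \<epsilon>\<close> by (rule order_tendstoD)
  show "\<forall>\<^sub>F n in sequentially. op_norm p (?P \<circ> (A' n - B)) < \<epsilon>"
    using ev by eventually_elim (use nn in \<open>smt (verit)\<close>)
  show "\<forall>\<^sub>F n in sequentially. op_norm p ((A' n - B) \<circ> ?P) < \<epsilon>"
    using ev by eventually_elim (use nn in \<open>smt (verit)\<close>)
qed

text \<open>Seen through the cube of radius \<open>m\<close>, the operator \<open>B\<close> is approximated by \<open>A\<close> shifted by \<open>h n\<close>,
  that is, by \<open>A\<close> seen through the set \<open>T\<close> of radius \<open>m\<close> around \<open>h n\<close>. Once \<open>h n\<close> has left the
  cube of radius \<open>k + m\<close>, the set \<open>T\<close> is disjoint from the cube of radius \<open>k\<close>, so \<open>K\<close> is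
  small there and may be added for free. The Fatou property removes the cube.\<close>
lemma op_norm_limit_op_le:
  fixes A B K :: "('n::finite, 'a::complex_banach) seq_op"
  assumes lim: "is_limit_op p A h B" and A: "A \<in> bounded_ops p" and K: "K \<in> P_compact_ops p"
  shows "op_norm p B \<le> op_norm p (A + K)"
proof -
  let ?P = "\<lambda>m. chi_op p (cube 0 m) :: ('n, 'a) seq_op"
  have B: "B \<in> bounded_ops p"
    using lim by (simp add: is_limit_op_def P_strongly_tendsto_def)
  have Kb: "K \<in> bounded_ops p" by (rule P_compact_bounded[OF K])
  have AK: "A + K \<in> bounded_ops p" by (rule bounded_ops_plus[OF p A Kb])
  have h: "\<forall>\<^sub>F n in sequentially. h n \<notin> cube 0 k" for k
    using lim by (simp add: is_limit_op_def tends_to_infinity_iff)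
  define A' where "A' = (\<lambda>n. shift_op p (- h n) \<circ> A \<circ> shift_op p (h n))"
  have A': "A' n \<in> bounded_ops p" for n
    unfolding A'_def by (intro bounded_ops_comp shift_op_bounded p A)
  have approx: "op_norm p (?P m \<circ> B) \<le> op_norm p (A + K) + 2 * \<epsilon>" if "0 < \<epsilon>" for m and \<epsilon> :: real
  proof -
    obtain k where k: "op_norm p (chi_op p (- cube 0 k) \<circ> K) < \<epsilon>"
      by (rule P_compact_tail[OF K \<open>0 < \<epsilon>\<close>])
    have "\<forall>\<^sub>F n in sequentially. op_norm p (?P m \<circ> (A' n - B)) < \<epsilon> \<and> h n \<notin> cube 0 (k + m)"
      unfolding A'_def by (intro eventually_conj limit_op_tendsto[OF lim A \<open>0 < \<epsilon>\<close>] h)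
    then obtain n where n: "op_norm p (?P m \<circ> (A' n - B)) < \<epsilon>" "h n \<notin> cube 0 (k + m)"
      by (auto simp: eventually_sequentially)
    define T where "T = {i. i + - h n \<in> cube 0 m}"
    let ?T = "chi_op p T :: ('n, 'a) seq_op"
    have "T \<inter> - cube 0 k = T"
    proof -
      have "h n \<in> cube 0 (k + m)" if "i \<in> T" "i \<in> cube 0 k" for i
      proof -
        have "i \<in> cube (h n) m"
          using that(1) by (simp add: T_def cube_translate[of i "h n"])
        then have "h n \<in> cube i m" by (simp add: cube_sym)
        then show ?thesis using cube_subset[OF that(2)] by blast
      qed
      then show ?thesis using n(2) by blast
    qed
    then have TQ: "?T = ?T \<circ> chi_op p (- cube 0 k)"
      by (simp add: chi_op_comp[OF p])
    have "op_norm p (?T \<circ> K) \<le> op_norm p (chi_op p (- cube 0 k) \<circ> K)"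
      by (subst TQ, unfold comp_assoc)
        (intro op_norm_comp_le_right bounded_ops_comp chi_op_bounded p Kb)
    then have TK: "op_norm p (?T \<circ> K) < \<epsilon>" using k by simp
    have "op_norm p (?P m \<circ> A' n) = op_norm p (shift_op p (- h n) \<circ> (?T \<circ> A \<circ> shift_op p (h n)))"
      using chi_op_shift[OF p, of "cube 0 m" "- h n", where ?'a = 'a]
      by (simp add: A'_def T_def flip: comp_assoc)
    also have "\<dots> \<le> op_norm p (?T \<circ> A \<circ> shift_op p (h n))"
      by (intro op_norm_comp_le_right bounded_ops_comp chi_op_bounded shift_op_bounded p A)
    also have "\<dots> \<le> op_norm p (?T \<circ> A)"
      by (intro op_norm_comp_le_left bounded_ops_comp chi_op_bounded shift_op_bounded p A)
    also have "?T \<circ> A = (?T \<circ> (A + K)) - (?T \<circ> K)"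
      using comp_diff_right[OF p AK Kb chi_op_bounded(1)[OF p], of T] by simp
    also have "op_norm p \<dots> \<le> op_norm p (?T \<circ> (A + K)) + op_norm p (- (?T \<circ> K))"
      using bounded_ops_plus(2)[OF p bounded_ops_comp(1)[OF p chi_op_bounded(1)[OF p] AK]
          bounded_ops_uminus(1)[OF p bounded_ops_comp(1)[OF p chi_op_bounded(1)[OF p] Kb]], of T T]
      by simp
    also have "op_norm p (- (?T \<circ> K)) = op_norm p (?T \<circ> K)"
      by (intro bounded_ops_uminus bounded_ops_comp chi_op_bounded p Kb)
    also have "op_norm p (?T \<circ> (A + K)) \<le> op_norm p (A + K)"
      by (intro op_norm_comp_le_right chi_op_bounded p AK)
    finally have PA: "op_norm p (?P m \<circ> A' n) \<le> op_norm p (A + K) + \<epsilon>"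
      using TK by linarith
    have PB: "?P m \<circ> B \<in> bounded_ops p" "?P m \<circ> A' n \<in> bounded_ops p"
      by (intro bounded_ops_comp chi_op_bounded p B A')+
    have "op_norm p (?P m \<circ> B) \<le> op_norm p (?P m \<circ> A' n) + op_norm p ((?P m \<circ> A' n) - (?P m \<circ> B))"
      using op_norm_diff_le[OF PB] op_norm_diff_commute[OF PB] by simp
    then show ?thesis
      using PA n(1) comp_diff_right[OF p A' B chi_op_bounded(1)[OF p], of "cube 0 m" n] by simp
  qed
  have cut: "op_norm p (?P m \<circ> B) \<le> op_norm p (A + K)" for m
  proof (rule field_le_epsilon)
    fix e :: real assume "0 < e"
    then show "op_norm p (?P m \<circ> B) \<le> op_norm p (A + K) + e"
      using approx[of "e / 2" m] by simp
  qed
  have loc: "lp_norm p (restr (cube 0 m) (B x)) \<le> op_norm p (A + K) * lp_norm p x"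
    if x: "x \<in> lp_space p" for m x
  proof -
    have "lp_norm p (restr (cube 0 m) (B x)) = lp_norm p ((?P m \<circ> B) x)"
      using bounded_ops_mem[OF B x] by (simp add: chi_op_def on_lp_def)
    also have "\<dots> \<le> op_norm p (?P m \<circ> B) * lp_norm p x"
      by (intro op_norm_apply bounded_ops_comp chi_op_bounded p B x)
    also have "\<dots> \<le> op_norm p (A + K) * lp_norm p x"
      by (intro mult_right_mono cut lp_norm_nonneg p x)
    finally show ?thesis .
  qed
  show ?thesis
  proof (rule op_norm_le[OF p op_norm_nonneg[OF p AK]])
    fix x :: "('n, 'a) lattice_seq" assume x: "x \<in> lp_space p"
    show "lp_norm p (B x) \<le> op_norm p (A + K) * lp_norm p x"
      by (rule lp_norm_le_if_cubes[OF p bounded_ops_mem[OF B x] loc[OF x]])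
  qed
qed

text \<open>The perturbation \<open>K = - A P\<^sub>n\<close> is \<open>\<P>\<close>-compact and \<open>A + K = A Q\<^sub>n\<close>.\<close>
lemma quotient_norm_le_tail:
  fixes A :: "('n::finite, 'a::complex_banach) seq_op"
  assumes A: "A \<in> band_dominated_ops p"
  shows "quotient_norm p A \<le> op_norm p (A \<circ> chi_op p (- cube 0 n))"
proof -
  let ?P = "chi_op p (cube 0 n) :: ('n, 'a) seq_op"
  let ?Q = "chi_op p (- cube 0 n) :: ('n, 'a) seq_op"
  have Ab: "A \<in> bounded_ops p" using A by (simp add: band_dominated_ops_def)
  have "A \<circ> ?Q = A + - (A \<circ> ?P)"
  proof (rule ext)
    fix x
    show "(A \<circ> ?Q) x = (A + - (A \<circ> ?P)) x"
    proof (cases "x \<in> lp_space p")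
      case True
      have "restr (- cube 0 n) x = x - restr (cube 0 n) x"
        by (auto simp: restr_def)
      then show ?thesis
        using True bounded_ops_diff[OF p Ab True lp_restr(1)[OF p True], of "cube 0 n"]
        by (simp add: chi_op_def on_lp_def)
    next
      case False
      then show ?thesis
        by (simp add: chi_op_def on_lp_def bounded_ops_off[OF Ab] bounded_ops_zero[OF p Ab])
    qed
  qed
  moreover have "quotient_norm p A \<le> op_norm p (A + - (A \<circ> ?P))"
    unfolding quotient_norm_def
  proof (rule cINF_lower)
    show "bdd_below ((\<lambda>K. op_norm p (A + K)) ` P_compact_ops p)"
      using op_norm_nonneg[OF p bounded_ops_plus(1)[OF p Ab P_compact_bounded]]
      by (intro bdd_belowI[where m = 0]) auto
    show "- (A \<circ> ?P) \<in> P_compact_ops p"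
      by (intro P_compact_uminus P_compact_band_dominated_chi A)
  qed
  ultimately show ?thesis by simp
qed

text \<open>Choosing the centre for the set outside the cube of radius \<open>n\<close> drives the centres to infinity,
  while the norms on these sets never drop below the essential norm.\<close>
lemma escaping_localization:
  fixes A :: "('n::finite, 'a::complex_banach) seq_op"
  assumes A: "A \<in> band_dominated_ops p"
  obtains h :: "nat \<Rightarrow> int ^ 'n" and D :: "nat \<Rightarrow> nat" where "tends_to_infinity h"
    and "\<And>n k. k \<le> n \<Longrightarrow>
          quotient_norm p A - 2 / 2 ^ k \<le> op_norm p (A \<circ> chi_op p (cube (h n) (D k)))"
proof -
  obtain D :: "nat \<Rightarrow> nat" where D: "\<And>F n. F \<noteq> {} \<Longrightarrow> \<exists>h\<in>F. \<forall>k\<le>n.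
      op_norm p (A \<circ> chi_op p F) - 2 / 2 ^ k \<le> op_norm p (A \<circ> chi_op p (cube h (D k)))"
    using simultaneous_localization[OF A] by metis
  have ne: "- cube 0 n \<noteq> ({} :: (int ^ 'n) set)" for n
  proof -
    have "(\<chi> j. int n + 1) \<in> - cube (0 :: int ^ 'n) n" by (simp add: cube_def)
    then show ?thesis by blast
  qed
  from D[OF ne] have "\<forall>n. \<exists>h\<in>- cube 0 n. \<forall>k\<le>n. op_norm p (A \<circ> chi_op p (- cube 0 n)) - 2 / 2 ^ k
      \<le> op_norm p (A \<circ> chi_op p (cube h (D k)))" by blast
  then obtain h where h: "\<And>n. h n \<in> - cube 0 n" and
    le: "\<And>n k. k \<le> n \<Longrightarrow> op_norm p (A \<circ> chi_op p (- cube 0 n)) - 2 / 2 ^ k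
      \<le> op_norm p (A \<circ> chi_op p (cube (h n) (D k)))" by metis
  have "h n \<notin> cube 0 k" if "k \<le> n" for n k
    using h[of n] cube_mono[OF that] by blast
  then have "tends_to_infinity h"
    unfolding tends_to_infinity_iff eventually_sequentially by blast
  then show thesis
    using le quotient_norm_le_tail[OF A] by (intro that[of h D]) (auto intro: order.trans[OF diff_right_mono])
qed

text \<open>Shifts are isometric, so the norm of \<open>A\<close> on the cube about \<open>g n\<close> is that of the shifted operator
  on the cube of the same radius about the origin, which converges to that of \<open>B\<close>.\<close>
lemma le_op_norm_limit_op:
  fixes A B :: "('n::finite, 'a::complex_banach) seq_op"
  assumes lim: "is_limit_op p A g B" and A: "A \<in> bounded_ops p"
    and loc: "\<And>k. \<forall>\<^sub>F n in sequentially.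
          c - 2 / 2 ^ k \<le> op_norm p (A \<circ> chi_op p (cube (g n) (D k)))"
  shows "c \<le> op_norm p B"
proof -
  have B: "B \<in> bounded_ops p"
    using lim by (simp add: is_limit_op_def P_strongly_tendsto_def)
  define A' where "A' = (\<lambda>n. shift_op p (- g n) \<circ> A \<circ> shift_op p (g n))"
  have A': "A' n \<in> bounded_ops p" for n
    unfolding A'_def by (intro bounded_ops_comp shift_op_bounded p A)
  have "c \<le> op_norm p B + 3 / 2 ^ k" for k
  proof -
    let ?P = "chi_op p (cube 0 (D k)) :: ('n, 'a) seq_op"
    have "\<forall>\<^sub>F n in sequentially. op_norm p ((A' n - B) \<circ> ?P) < 1 / 2 ^ k \<and>
        c - 2 / 2 ^ k \<le> op_norm p (A \<circ> chi_op p (cube (g n) (D k)))"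
      unfolding A'_def by (intro eventually_conj limit_op_tendsto[OF lim A] loc) simp
    then obtain n where n: "op_norm p ((A' n - B) \<circ> ?P) < 1 / 2 ^ k"
        "c - 2 / 2 ^ k \<le> op_norm p (A \<circ> chi_op p (cube (g n) (D k)))"
      by (auto simp: eventually_sequentially)
    \<comment> \<open>The restriction of \<open>A\<close> to the cube about \<open>g n\<close> is a shifted copy of the restriction of \<open>A' n\<close> to the
      cube about the origin.\<close>
    let ?C = "chi_op p (cube (g n) (D k)) :: ('n, 'a) seq_op"
    have "{i. i + g n \<in> cube (g n) (D k)} = cube 0 (D k)"
      by (simp add: cube_def)
    then have sh: "?C \<circ> shift_op p (g n) = shift_op p (g n) \<circ> ?P"
      using chi_op_shift[OF p, of "cube (g n) (D k)" "g n", where ?'a = 'a] by simp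
    have "shift_op p (g n) \<circ> (A' n \<circ> ?P) \<circ> shift_op p (- g n)
        = (shift_op p (g n) \<circ> shift_op p (- g n)) \<circ> A \<circ> (shift_op p (g n) \<circ> ?P) \<circ> shift_op p (- g n)"
      by (simp add: A'_def comp_assoc)
    also have "\<dots> = shift_op p 0 \<circ> (A \<circ> ?C)"
      unfolding sh[symmetric]
      by (simp add: comp_assoc shift_op_comp[OF p] comp_shift_0[OF p chi_op_bounded(1)[OF p]])
    also have "\<dots> = A \<circ> ?C"
    proof (rule ext)
      fix x show "(shift_op p 0 \<circ> (A \<circ> ?C)) x = (A \<circ> ?C) x"
        using bounded_ops_mem[OF bounded_ops_comp(1)[OF p A chi_op_bounded(1)[OF p]], of x]
          bounded_ops_off[OF bounded_ops_comp(1)[OF p A chi_op_bounded(1)[OF p]], of x]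
        by (cases "x \<in> lp_space p") (auto simp: shift_op_def on_lp_def zero_mem_lp[OF p])
    qed
    finally have eq: "A \<circ> ?C = shift_op p (g n) \<circ> (A' n \<circ> ?P) \<circ> shift_op p (- g n)" ..
    have bd: "A' n \<circ> ?P \<in> bounded_ops p" "B \<circ> ?P \<in> bounded_ops p"
      by (intro bounded_ops_comp chi_op_bounded p A' B)+
    have "op_norm p (A \<circ> ?C) \<le> op_norm p (shift_op p (g n) \<circ> (A' n \<circ> ?P))"
      unfolding eq by (intro op_norm_comp_le_left bounded_ops_comp shift_op_bounded p bd)
    also have "\<dots> \<le> op_norm p (A' n \<circ> ?P)"
      by (intro op_norm_comp_le_right shift_op_bounded p bd)
    also have "\<dots> \<le> op_norm p (B \<circ> ?P) + op_norm p ((A' n - B) \<circ> ?P)"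
      using op_norm_diff_le[OF bd] by (simp add: comp_diff_left)
    also have "op_norm p (B \<circ> ?P) \<le> op_norm p B"
      by (intro op_norm_comp_le_left chi_op_bounded p B)
    finally have "c - 2 / 2 ^ k \<le> op_norm p B + 1 / 2 ^ k"
      using n by linarith
    then show ?thesis by simp
  qed
  moreover have "(\<lambda>k. op_norm p B + 3 / 2 ^ k) \<longlonglongrightarrow> op_norm p B + 0"
    by (intro tendsto_add tendsto_const LIMSEQ_divide_realpow_zero) simp
  ultimately show ?thesis
    by (intro LIMSEQ_le_const[where X = "\<lambda>k. op_norm p B + 3 / 2 ^ k"]) auto
qed

end

theorem theorem3p2:
  fixes p :: ereal
    and A :: "('n::finite, 'a::complex_banach) seq_op"
  assumes "\<exists>x::'a. x \<noteq> 0"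
    and "p = 0 \<or> 1 \<le> p"
    and "A \<in> rich_band_dominated_ops p"
  shows "quotient_norm p A \<in> op_norm p ` op_spectrum p A \<and>
    (\<forall>B\<in>op_spectrum p A. op_norm p B \<le> quotient_norm p A)"
proof -
  note p = assms(2)
  have A: "A \<in> band_dominated_ops p" and rich: "rich p A"
    using assms(3) by (simp_all add: rich_band_dominated_ops_def)
  have Ab: "A \<in> bounded_ops p" using A by (simp add: band_dominated_ops_def)
  have upper: "op_norm p B \<le> quotient_norm p A" if "B \<in> op_spectrum p A" for B
    unfolding quotient_norm_def
  proof (rule cINF_greatest)
    show "P_compact_ops p \<noteq> ({} :: ('n, 'a) seq_op set)"
      using P_compact_chi[OF p] by blast
    show "op_norm p B \<le> op_norm p (A + K)" if "K \<in> P_compact_ops p" for K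
      using \<open>B \<in> op_spectrum p A\<close> op_norm_limit_op_le[OF p _ Ab that]
      by (auto simp: op_spectrum_def)
  qed
  obtain h D where h: "tends_to_infinity h" and
    loc: "\<And>n k. k \<le> n \<Longrightarrow>
          quotient_norm p A - 2 / 2 ^ k \<le> op_norm p (A \<circ> chi_op p (cube (h n) (D k)))"
    by (rule escaping_localization[OF p A]) blast
  obtain r B where r: "strict_mono r" and B: "is_limit_op p A (h \<circ> r) B"
    using rich h unfolding rich_def by blast
  have "\<forall>\<^sub>F n in sequentially.
      quotient_norm p A - 2 / 2 ^ k \<le> op_norm p (A \<circ> chi_op p (cube ((h \<circ> r) n) (D k)))" for k
    unfolding eventually_sequentially
    using loc[OF order.trans[OF _ seq_suble[OF r]]] by auto
  from le_op_norm_limit_op[OF p B Ab this]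
  have "quotient_norm p A \<le> op_norm p B" .
  moreover have "B \<in> op_spectrum p A"
    using B by (auto simp: op_spectrum_def)
  ultimately show ?thesis
    using upper by (metis antisym image_eqI)
qed

end
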